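(* Let $(\mathbb{Z},b,m)$ be a star with two rays which is transient only at $-\infty$ (that is, transient at $-\infty$ and not transient at $\infty$). Then $(\mathbb{Z},b,m)$ does not satisfy the $\ell^2$-Liouville property if and only if $L_c^{(\infty)}$ is not essentially self-adjoint and at least one of the following holds: (1) $g\in\ell^2(-\infty)$. (2) $m(-\infty)<\infty$.
   Context: A star with two rays $(\mathbb{Z},b,m)$ consists of the vertex set $\mathbb{Z}$, a symmetric $b\colon\mathbb{Z}\times\mathbb{Z}\to[0,\infty)$ with $b(x,y)>0$ iff $|x-y|=1$, and $m\colon\mathbb{Z}\to(0,\infty)$. All functions are real-valued; $\ell^2(\mathbb{Z},m)$ is the space of $f$ with $\sum_x f^2(x)m(x)<\infty$. The formal Laplacian is $\Delta f(x)=\frac1{m(x)}\sum_y b(x,y)(f(x)-f(y))$. A function $f$ is harmonic if $\Delta f=0$. The $\ell^2$-Liouville property holds if every harmonic function in $\ell^2(\mathbb{Z},m)$ is constant. The graph is transient at $\infty$ if $\sum_{k=0}^\infty\frac1{b(k,k+1)}<\infty$ and transient at $-\infty$ if $\sum_{k=0}^\infty\frac1{b(-k,-k-1)}<\infty$. One writes $g\in\ell^2(-\infty)$ (the Green's function is in $\ell^2$ at negative infinity) if $\sum_{r=0}^\infty\left(\sum_{k=r}^\infty\frac1{b(-k,-k-1)}\right)^2m(-r)<\infty$. One writes $m(-\infty)<\infty$ if $\sum_{r=0}^\infty m(-r)<\infty$. $L_c^{(\infty)}$ is the Laplacian of the positive part of the graph, i.e. of the subgraph induced on $\{1,2,3,\ldots\}$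 (with $b$ and $m$ restricted), restricted to the finitely supported functions and viewed as an operator on the corresponding $\ell^2$ space. An operator is essentially self-adjoint if it has a unique self-adjoint extension (equivalently, its closure is self-adjoint). *)

theory Defs
  imports "HOL-Analysis.Analysis"
begin

section \<open>Weighted $\ell^2$ spaces and unbounded operators on them\<close>

text \<open>A function on a vertex set \<open>V\<close> is represented by a function on the whole type that
  vanishes outside \<open>V\<close>, so that equality of functions on \<open>V\<close> is equality in HOL.\<close>

definition wl2 :: "'a set \<Rightarrow> ('a \<Rightarrow> real) \<Rightarrow> ('a \<Rightarrow> real) set" where
  "wl2 V m = {f. (\<forall>x. x \<notin> V \<longrightarrow> f x = 0) \<and> (\<lambda>x. (f x)\<^sup>2 * m x) summable_on V}"

definition wl2_inner :: "'a set \<Rightarrow> ('a \<Rightarrow> real) \<Rightarrow> ('a \<Rightarrow> real) \<Rightarrow> ('a \<Rightarrow> real) \<Rightarrow> real" where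
  "wl2_inner V m f g = (\<Sum>\<^sub>\<infinity>x\<in>V. f x * g x * m x)"

definition wl2_norm :: "'a set \<Rightarrow> ('a \<Rightarrow> real) \<Rightarrow> ('a \<Rightarrow> real) \<Rightarrow> real" where
  "wl2_norm V m f = sqrt (wl2_inner V m f f)"

text \<open>Unbounded operators are identified with their graphs: \<open>(f, g) \<in> T\<close> means that \<open>f\<close> is in
  the domain of \<open>T\<close> and \<open>T f = g\<close>. The domain is \<open>Domain T\<close>, and \<open>T \<subseteq> A\<close> says that \<open>A\<close>
  extends \<open>T\<close>.\<close>

type_synonym 'a op_graph = "(('a \<Rightarrow> real) \<times> ('a \<Rightarrow> real)) set"

definition linear_op :: "'a set \<Rightarrow> ('a \<Rightarrow> real) \<Rightarrow> 'a op_graph \<Rightarrow> bool" where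
  "linear_op V m T \<longleftrightarrow>
     T \<subseteq> wl2 V m \<times> wl2 V m \<and> single_valued T \<and>
     (\<lambda>x. 0, \<lambda>x. 0) \<in> T \<and>
     (\<forall>f g f' g'. (f, g) \<in> T \<longrightarrow> (f', g') \<in> T \<longrightarrow> (\<lambda>x. f x + f' x, \<lambda>x. g x + g' x) \<in> T) \<and>
     (\<forall>c f g. (f, g) \<in> T \<longrightarrow> (\<lambda>x. c * f x, \<lambda>x. c * g x) \<in> T)"

definition densely_defined :: "'a set \<Rightarrow> ('a \<Rightarrow> real) \<Rightarrow> 'a op_graph \<Rightarrow> bool" where
  "densely_defined V m T \<longleftrightarrow>
     (\<forall>f\<in>wl2 V m. \<forall>\<epsilon>>0. \<exists>h\<in>Domain T. wl2_norm V m (\<lambda>x. f x - h x) < \<epsilon>)"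

text \<open>The Hilbert space adjoint; its graph is that of an operator when \<open>T\<close> is densely defined.\<close>

definition adjoint_op :: "'a set \<Rightarrow> ('a \<Rightarrow> real) \<Rightarrow> 'a op_graph \<Rightarrow> 'a op_graph" where
  "adjoint_op V m T =
     {(u, v). u \<in> wl2 V m \<and> v \<in> wl2 V m \<and>
        (\<forall>(f, g)\<in>T. wl2_inner V m g u = wl2_inner V m f v)}"

definition self_adjoint :: "'a set \<Rightarrow> ('a \<Rightarrow> real) \<Rightarrow> 'a op_graph \<Rightarrow> bool" where
  "self_adjoint V m A \<longleftrightarrow>
     linear_op V m A \<and> densely_defined V m A \<and> adjoint_op V m A = A"

definition essentially_self_adjoint :: "'a set \<Rightarrow> ('a \<Rightarrow> real) \<Rightarrow> 'a op_graph \<Rightarrow> bool" where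
  "essentially_self_adjoint V m T \<longleftrightarrow> (\<exists>!A. self_adjoint V m A \<and> T \<subseteq> A)"


section \<open>Laplacians of weighted graphs\<close>

text \<open>Edge weights and vertex measure are given on the whole type; taking a vertex set \<open>V\<close> means
  passing to the induced subgraph, where only neighbours in \<open>V\<close> contribute. The infinite sum has
  only finitely many non-zero terms when the graph is locally finite, as here.\<close>

definition formal_laplacian ::
    "'a set \<Rightarrow> ('a \<Rightarrow> 'a \<Rightarrow> real) \<Rightarrow> ('a \<Rightarrow> real) \<Rightarrow> ('a \<Rightarrow> real) \<Rightarrow> 'a \<Rightarrow> real" where
  "formal_laplacian V b m f x =
     (if x \<in> V then (1 / m x) * (\<Sum>\<^sub>\<infinity>y\<in>V. b x y * (f x - f y)) else 0)"

definition harmonic :: "'a set \<Rightarrow> ('a \<Rightarrow> 'a \<Rightarrow> real) \<Rightarrow> ('a \<Rightarrow> real) \<Rightarrow> ('a \<Rightarrow> real) \<Rightarrow> bool" where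
  "harmonic V b m f \<longleftrightarrow> (\<forall>x\<in>V. formal_laplacian V b m f x = 0)"

definition l2_Liouville :: "'a set \<Rightarrow> ('a \<Rightarrow> 'a \<Rightarrow> real) \<Rightarrow> ('a \<Rightarrow> real) \<Rightarrow> bool" where
  "l2_Liouville V b m \<longleftrightarrow> (\<forall>f\<in>wl2 V m. harmonic V b m f \<longrightarrow> f constant_on V)"

text \<open>The Laplacian restricted to the finitely supported functions.\<close>

definition laplacian_c :: "'a set \<Rightarrow> ('a \<Rightarrow> 'a \<Rightarrow> real) \<Rightarrow> ('a \<Rightarrow> real) \<Rightarrow> 'a op_graph" where
  "laplacian_c V b m =
     {(f, formal_laplacian V b m f) | f. finite {x. f x \<noteq> 0} \<and> {x. f x \<noteq> 0} \<subseteq> V}"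


section \<open>Stars with two rays\<close>

definition star_two_rays :: "(int \<Rightarrow> int \<Rightarrow> real) \<Rightarrow> (int \<Rightarrow> real) \<Rightarrow> bool" where
  "star_two_rays b m \<longleftrightarrow>
     (\<forall>x y. b x y = b y x) \<and> (\<forall>x y. 0 \<le> b x y) \<and>
     (\<forall>x y. 0 < b x y \<longleftrightarrow> \<bar>x - y\<bar> = 1) \<and> (\<forall>x. 0 < m x)"

definition transient_pos :: "(int \<Rightarrow> int \<Rightarrow> real) \<Rightarrow> bool" where
  "transient_pos b \<longleftrightarrow> summable (\<lambda>k::nat. 1 / b (int k) (int k + 1))"

definition transient_neg :: "(int \<Rightarrow> int \<Rightarrow> real) \<Rightarrow> bool" where
  "transient_neg b \<longleftrightarrow> summable (\<lambda>k::nat. 1 / b (- int k) (- int k - 1))"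

text \<open>Green's function is in $\ell^2$ at negative infinity. The inner sum over \<open>k \<ge> r\<close> is
  reindexed to start at \<open>0\<close>. If it diverges, the double sum is infinite; since \<open>suminf\<close> is
  unspecified in that case, convergence is required separately.\<close>

definition green_l2_neg :: "(int \<Rightarrow> int \<Rightarrow> real) \<Rightarrow> (int \<Rightarrow> real) \<Rightarrow> bool" where
  "green_l2_neg b m \<longleftrightarrow>
     transient_neg b \<and>
     summable (\<lambda>r::nat. (\<Sum>k. 1 / b (- int (r + k)) (- int (r + k) - 1))\<^sup>2 * m (- int r))"

definition finite_measure_neg :: "(int \<Rightarrow> real) \<Rightarrow> bool" where
  "finite_measure_neg m \<longleftrightarrow> summable (\<lambda>r::nat. m (- int r))"

end

(* A harmonic function has constant flux c through all edges, so it is a + c G, where G is the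
   potential vanishing at minus infinity with unit flux; G diverges at plus infinity. Hence a
   nonconstant harmonic function in l^2 exists iff G is in l^2 near plus infinity and either G
   itself (a = 0) or the constants (a nonzero) are in l^2 near minus infinity.

   On the positive ray put S(n) = 1/b(1,2) + ... + 1/b(n,n+1); this differs from G by a constant.
   The adjoint of L_c is the maximal operator, and its boundary form is the limit of the
   Wronskians. If S is in l^2, so are the constants, and the pair (1, S) has Wronskian 1; the
   boundary conditions W(u, 1) = 0 and W(u, S) = 0 give two different self-adjoint extensions.
   If S is not in l^2, every function in the maximal domain has finite energy, and on a recurrent
   ray the Wronskian of two functions of finite energy tends to 0 along a subsequence, so the
   adjoint is symmetric. *)

theory Submission
  imports Defs
begin

section \<open>Sequences with finite and infinite energy\<close>

text \<open>Since \<open>ln (1 + x) \<le> x\<close>, each step raises \<open>ln (s n)\<close> by at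
  most \<open>B * \<sigma> n / s n\<close>. A convergent quotient series would thus bound
  \<open>s\<close>, and with it the partial sums of \<open>\<sigma>\<close>.\<close>

lemma not_summable_div_partial_sums:
  fixes \<sigma> :: "nat \<Rightarrow> real"
  assumes \<sigma>: "\<And>n. 0 \<le> \<sigma> n" and ns: "\<not> summable \<sigma>" and A: "0 < A" and B: "0 < B"
  shows "\<not> summable (\<lambda>n. \<sigma> n / (A + B * (\<Sum>k<n. \<sigma> k)))"
proof
  define s where "s n = A + B * (\<Sum>k<n. \<sigma> k)" for n
  assume "summable (\<lambda>n. \<sigma> n / (A + B * (\<Sum>k<n. \<sigma> k)))"
  then have sm: "summable (\<lambda>n. \<sigma> n / s n)" by (simp add: s_def)
  have s0: "s n > 0" for n
    using A B \<sigma> by (simp add: s_def add_pos_nonneg sum_nonneg)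
  have ln_le: "ln (s n) \<le> ln A + B * (\<Sum>k<n. \<sigma> k / s k)" for n
  proof (induction n)
    case (Suc n)
    have "s (Suc n) / s n = 1 + B * (\<sigma> n / s n)"
      using s0[of n] by (simp add: s_def field_simps)
    moreover have "0 \<le> B * (\<sigma> n / s n)"
      using B \<sigma>[of n] s0[of n] by simp
    ultimately have "ln (s (Suc n) / s n) \<le> B * (\<sigma> n / s n)"
      by (metis ln_add_one_self_le_self)
    with Suc s0[of n] s0[of "Suc n"] show ?case
      by (simp add: ln_div algebra_simps)
  qed (simp add: s_def)
  have bd: "(\<Sum>k<n. \<sigma> k / s k) \<le> (\<Sum>k. \<sigma> k / s k)" for n
    using sm \<sigma> s0 by (intro sum_le_suminf) (auto simp: less_imp_le)
  have "(\<Sum>k<n. \<sigma> k) \<le> exp (ln A + B * (\<Sum>k. \<sigma> k / s k)) / B" for n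
  proof -
    have "ln (s n) \<le> ln A + B * (\<Sum>k. \<sigma> k / s k)"
      using ln_le[of n] mult_left_mono[OF bd[of n], of B] B by linarith
    then have "s n \<le> exp (ln A + B * (\<Sum>k. \<sigma> k / s k))"
      using s0[of n] by (metis exp_ln exp_le_cancel_iff)
    then have "B * (\<Sum>k<n. \<sigma> k) \<le> exp (ln A + B * (\<Sum>k. \<sigma> k / s k))"
      using A unfolding s_def by linarith
    then show ?thesis using B by (simp add: field_simps)
  qed
  then have "summable \<sigma>"
    using \<sigma> by (intro summableI_nonneg_bounded) auto
  with ns show False ..
qed

text \<open>Cauchy-Schwarz for the telescoping sum of increments, each split into the factors
  \<open>sqrt (\<beta> k) * (u (Suc k) - u k)\<close> and
  \<open>1 / sqrt (\<beta> k)\<close>.\<close>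

lemma square_le_energy:
  fixes u \<beta> :: "nat \<Rightarrow> real"
  assumes \<beta>: "\<And>n. 0 < \<beta> n" and E: "summable (\<lambda>n. \<beta> n * (u (Suc n) - u n)\<^sup>2)"
  shows "(u n)\<^sup>2 \<le> 2 * (u 0)\<^sup>2 + 2 * (\<Sum>k. \<beta> k * (u (Suc k) - u k)\<^sup>2) * (\<Sum>k<n. 1 / \<beta> k)"
proof -
  have "(u n - u 0)\<^sup>2 = (\<Sum>k<n. (sqrt (\<beta> k) * (u (Suc k) - u k)) * (1 / sqrt (\<beta> k)))\<^sup>2"
    using \<beta> by (simp add: sum_lessThan_telescope order_less_imp_not_eq2)
  also have "\<dots> \<le> (\<Sum>k<n. (sqrt (\<beta> k) * (u (Suc k) - u k))\<^sup>2) * (\<Sum>k<n. (1 / sqrt (\<beta> k))\<^sup>2)"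
    by (rule Cauchy_Schwarz_ineq_sum)
  also have "\<dots> = (\<Sum>k<n. \<beta> k * (u (Suc k) - u k)\<^sup>2) * (\<Sum>k<n. 1 / \<beta> k)"
    using \<beta> by (simp add: power_mult_distrib power_divide less_imp_le)
  also have "\<dots> \<le> (\<Sum>k. \<beta> k * (u (Suc k) - u k)\<^sup>2) * (\<Sum>k<n. 1 / \<beta> k)"
    using \<beta> E by (intro mult_right_mono sum_le_suminf sum_nonneg) (auto simp: less_imp_le)
  finally have "(u n - u 0)\<^sup>2 \<le> (\<Sum>k. \<beta> k * (u (Suc k) - u k)\<^sup>2) * (\<Sum>k<n. 1 / \<beta> k)" .
  moreover have "(u n)\<^sup>2 \<le> 2 * (u 0)\<^sup>2 + 2 * (u n - u 0)\<^sup>2"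
    using zero_le_power2[of "u n - 2 * u 0"] by (simp add: power2_eq_square algebra_simps)
  ultimately show ?thesis by (simp add: algebra_simps)
qed

text \<open>Finite energy gives \<open>u\<^sup>2 + w\<^sup>2 \<le> A + B s\<close> with \<open>s\<close> the resistance from the origin. A Wronskian bounded
  away from \<open>0\<close> forces, by Cauchy-Schwarz, \<open>1 / (\<beta> (u\<^sup>2 + w\<^sup>2))\<close> to be dominated by the energy density,
  contradicting the Abel-Dini divergence of \<open>\<Sum>n. (1 / \<beta> n) / (A + B s n)\<close>.\<close>

lemma wronskian_limit_zero:
  fixes u w \<beta> :: "nat \<Rightarrow> real"
  assumes \<beta>: "\<And>n. 0 < \<beta> n" and ns: "\<not> summable (\<lambda>n. 1 / \<beta> n)"
    and Eu: "summable (\<lambda>n. \<beta> n * (u (Suc n) - u n)\<^sup>2)"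
    and Ew: "summable (\<lambda>n. \<beta> n * (w (Suc n) - w n)\<^sup>2)"
    and lim: "(\<lambda>n. \<beta> n * (u n * w (Suc n) - u (Suc n) * w n)) \<longlonglongrightarrow> c"
  shows "c = 0"
proof (rule ccontr)
  assume c: "c \<noteq> 0"
  define e where "e n = \<beta> n * (u (Suc n) - u n)\<^sup>2 + \<beta> n * (w (Suc n) - w n)\<^sup>2" for n
  \<comment> \<open>The summand \<open>1\<close> here and in \<open>B\<close> makes both constants
    strictly positive, as the divergence lemma requires.\<close>
  define A where "A = 2 * (u 0)\<^sup>2 + 2 * (w 0)\<^sup>2 + 1"
  define B where "B = 2 * (\<Sum>k. \<beta> k * (u (Suc k) - u k)\<^sup>2) +
    2 * (\<Sum>k. \<beta> k * (w (Suc k) - w k)\<^sup>2) + 1"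
  define s where "s n = (\<Sum>k<n. 1 / \<beta> k)" for n
  have e: "summable e" unfolding e_def by (intro summable_add Eu Ew)
  have s0: "0 \<le> s n" for n using \<beta> by (simp add: s_def sum_nonneg less_imp_le)
  have A: "0 < A" by (simp add: A_def add_nonneg_pos)
  have B: "0 < B"
    unfolding B_def using \<beta> Eu Ew
    by (intro add_nonneg_pos add_nonneg_nonneg mult_nonneg_nonneg suminf_nonneg) (auto simp: less_imp_le)
  have N: "(u n)\<^sup>2 + (w n)\<^sup>2 \<le> A + B * s n" for n
    using square_le_energy[OF \<beta> Eu, of n] square_le_energy[OF \<beta> Ew, of n] s0[of n]
    by (simp add: A_def B_def s_def algebra_simps)
  have "\<forall>\<^sub>F n in sequentially. \<bar>c\<bar> / 2 < \<bar>\<beta> n * (u n * w (Suc n) - u (Suc n) * w n)\<bar>"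
    using c by (intro order_tendstoD[OF tendsto_rabs[OF lim]]) auto
  then have "\<forall>\<^sub>F n in sequentially. norm (1 / \<beta> n / (A + B * s n)) \<le> 4 / c\<^sup>2 * e n"
  proof eventually_elim
    case (elim n)
    \<comment> \<open>The Wronskian in terms of increments; the products \<open>u n * w n\<close>
      cancel.\<close>
    let ?W = "u n * (w (Suc n) - w n) - w n * (u (Suc n) - u n)"
    have d: "0 < A + B * s n" using A B s0[of n] by (simp add: add_pos_nonneg)
    have "c\<^sup>2 / 4 \<le> (\<beta> n * ?W)\<^sup>2"
    proof -
      have "(\<bar>c\<bar> / 2)\<^sup>2 \<le> \<bar>\<beta> n * ?W\<bar>\<^sup>2"
        using elim by (intro power_mono) (auto simp: algebra_simps)
      then show ?thesis by (simp add: power_divide)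
    qed
    also have "\<dots> = (\<beta> n)\<^sup>2 * ?W\<^sup>2" by (simp add: power_mult_distrib)
    also have "\<dots> \<le> (\<beta> n)\<^sup>2 * (((u n)\<^sup>2 + (w n)\<^sup>2) * ((w (Suc n) - w n)\<^sup>2 + (u (Suc n) - u n)\<^sup>2))"
    proof (rule mult_left_mono)
      \<comment> \<open>Lagrange's identity, that is, Cauchy-Schwarz in the plane with an explicit
        remainder.\<close>
      have "((u n)\<^sup>2 + (w n)\<^sup>2) * ((w (Suc n) - w n)\<^sup>2 + (u (Suc n) - u n)\<^sup>2) - ?W\<^sup>2
        = (u n * (u (Suc n) - u n) + w n * (w (Suc n) - w n))\<^sup>2"
        by algebra
      then show "?W\<^sup>2 \<le> ((u n)\<^sup>2 + (w n)\<^sup>2) * ((w (Suc n) - w n)\<^sup>2 + (u (Suc n) - u n)\<^sup>2)"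
        by (metis diff_ge_0_iff_ge zero_le_power2)
    qed simp
    also have "\<dots> = \<beta> n * e n * ((u n)\<^sup>2 + (w n)\<^sup>2)"
      unfolding e_def by algebra
    also have "\<dots> \<le> \<beta> n * e n * (A + B * s n)"
      using \<beta>[of n] by (intro mult_left_mono N) (simp add: e_def less_imp_le)
    finally have "c\<^sup>2 / 4 \<le> \<beta> n * e n * (A + B * s n)" .
    \<comment> \<open>An arbitrary positive \<open>D\<close> in place of the denominator keeps it
      atomic for \<open>field_simps\<close>.\<close>
    moreover have "c\<^sup>2 / 4 \<le> \<beta> n * e n * D \<Longrightarrow> norm (1 / \<beta> n / D) \<le> 4 / c\<^sup>2 * e n"
      if "0 < D" for D
      using \<beta>[of n] c that by (simp add: field_simps)
    ultimately show ?case using d by blast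
  qed
  then have "summable (\<lambda>n. 1 / \<beta> n / (A + B * s n))"
    by (rule summable_comparison_test_ev) (intro summable_mult e)
  with not_summable_div_partial_sums[of "\<lambda>n. 1 / \<beta> n" A B] \<beta> ns A B show False
    by (simp add: s_def less_imp_le)
qed

text \<open>Here \<open>p u\<close> is the boundary term of Green's formula, and \<open>p u \<ge> C + 1\<close> is what infinite energy
  provides. Then \<open>u\<close> increases, so the change of \<open>u N * p\<close> after \<open>N\<close> is at most \<open>C\<close>; the flux \<open>p\<close> stays
  bounded below and \<open>u\<close> grows at least like the resistance.\<close>

lemma unbounded_energy_growth:
  fixes u v p \<beta> \<mu> :: "nat \<Rightarrow> real"
  assumes \<beta>: "\<And>n. 0 < \<beta> n" and \<mu>: "\<And>n. 0 < \<mu> n"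
    and u: "summable (\<lambda>n. (u n)\<^sup>2 * \<mu> n)"
    and p: "\<And>n. p n = \<beta> n * (u (Suc n) - u n)"
    and v: "\<And>n. v (Suc n) * \<mu> (Suc n) = p n - p (Suc n)"
    and C: "\<And>n. (\<Sum>k<n. \<bar>u k * v k * \<mu> k\<bar>) \<le> C"
    and N: "\<And>n. N \<le> n \<Longrightarrow> C + 1 \<le> p n * u n"
    and uN: "0 < u N"
  shows "summable (\<lambda>n. (\<Sum>k<n. 1 / \<beta> k)\<^sup>2 * \<mu> n)"
proof -
  define S where "S n = (\<Sum>k<n. 1 / \<beta> k)" for n
  have C0: "0 \<le> C" using C[of 0] by simp
  \<comment> \<open>Signs propagate: positive flux keeps \<open>u\<close> positive at the next
    vertex, and the positive product \<open>p n * u n\<close> there makes the next flux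
    positive.\<close>
  have mono: "u N \<le> u (N + d) \<and> 0 < p (N + d)" for d
  proof (induction d)
    case 0
    have "0 < p N * u N" using N[of N] C0 by simp
    then show ?case using uN by (simp add: zero_less_mult_iff)
  next
    case (Suc d)
    then have "u (N + d) < u (Suc (N + d))"
      using p[of "N + d"] \<beta>[of "N + d"] by (simp add: zero_less_mult_iff)
    moreover have "0 < p (Suc (N + d)) * u (Suc (N + d))"
      using N[of "Suc (N + d)"] C0 by simp
    ultimately show ?case
      using Suc uN by (auto simp: zero_less_mult_iff)
  qed
  \<comment> \<open>Each flux drop is \<open>v * \<mu>\<close> at the new vertex, and its weight
    \<open>u N\<close> may be raised to the larger value of \<open>u\<close> there.\<close>
  have flux: "u N * (p N - p (N + d)) \<le> (\<Sum>k=Suc N..<Suc (N + d). \<bar>u k * v k * \<mu> k\<bar>)" for d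
  proof (induction d)
    case (Suc d)
    let ?k = "Suc (N + d)"
    have "u N * (p (N + d) - p ?k) \<le> \<bar>u N * (v ?k * \<mu> ?k)\<bar>"
      using v[of "N + d"] by simp
    also have "\<dots> = u N * \<bar>v ?k * \<mu> ?k\<bar>"
      using uN by (simp add: abs_mult)
    also have "\<dots> \<le> u ?k * \<bar>v ?k * \<mu> ?k\<bar>"
      using mono[of "Suc d"] by (intro mult_right_mono) auto
    also have "\<dots> = \<bar>u ?k * v ?k * \<mu> ?k\<bar>"
      using mono[of "Suc d"] uN by (simp add: abs_mult)
    finally have "u N * (p (N + d) - p ?k) \<le> \<bar>u ?k * v ?k * \<mu> ?k\<bar>" .
    with Suc show ?case by (simp add: algebra_simps)
  qed simp
  have pk: "1 \<le> u N * p (N + d)" for d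
  proof -
    have "(\<Sum>k=Suc N..<Suc (N + d). \<bar>u k * v k * \<mu> k\<bar>) \<le> (\<Sum>k<Suc (N + d). \<bar>u k * v k * \<mu> k\<bar>)"
      by (rule sum_mono2) auto
    also have "\<dots> \<le> C" by (rule C)
    finally show ?thesis
      using flux[of d] N[of N] by (simp add: algebra_simps)
  qed
  have SN: "S (N + d) - S N \<le> u N * u (N + d)" for d
  proof (induction d)
    case (Suc d)
    have "u (N + Suc d) - u (N + d) = p (N + d) / \<beta> (N + d)"
      using p[of "N + d"] \<beta>[of "N + d"] by (simp add: field_simps)
    then have "u N * (u (N + Suc d) - u (N + d)) = u N * p (N + d) / \<beta> (N + d)"
      by simp
    also have "\<dots> \<ge> 1 / \<beta> (N + d)"
      using pk[of d] \<beta>[of "N + d"] by (simp add: divide_right_mono)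
    finally show ?case using Suc by (simp add: S_def algebra_simps)
  qed (use uN in simp)
  \<comment> \<open>For \<open>n \<ge> N\<close>, \<open>S n - S N\<close> is at most
    \<open>u N * u n\<close>, and \<open>S N\<close> is at most \<open>S N / u N * u n\<close>
    because \<open>u n \<ge> u N\<close>.\<close>
  define K where "K = u N + S N / u N"
  have S0: "0 \<le> S n" for n using \<beta> by (simp add: S_def sum_nonneg less_imp_le)
  have SK: "S n \<le> K * u n" if le: "N \<le> n" for n
  proof -
    obtain d where n: "n = N + d" using le by (auto simp: le_iff_add)
    have "S N \<le> S N / u N * u n"
      using mono[of d] uN S0[of N] n mult_left_mono[of "u N" "u n" "S N / u N"] by simp
    then show ?thesis using SN[of d] n by (simp add: K_def algebra_simps)
  qed
  have "summable (\<lambda>n. (S n)\<^sup>2 * \<mu> n)"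
  proof (rule summable_comparison_test')
    show "summable (\<lambda>n. K\<^sup>2 * ((u n)\<^sup>2 * \<mu> n))" by (intro summable_mult u)
    fix n assume "N \<le> n"
    then have "(S n)\<^sup>2 \<le> (K * u n)\<^sup>2" using SK S0 by (intro power_mono)
    then show "norm ((S n)\<^sup>2 * \<mu> n) \<le> K\<^sup>2 * ((u n)\<^sup>2 * \<mu> n)"
      using \<mu>[of n] by (simp add: power_mult_distrib)
  qed
  then show ?thesis by (simp add: S_def)
qed

text \<open>By Green's formula the boundary term \<open>p n * u n\<close> is the energy up to
  \<open>n\<close> minus a sum bounded by \<open>C\<close>. Infinite energy therefore drives it
  above \<open>C + 1\<close>, and the growth lemma applies to \<open>u\<close> or to
  \<open>- u\<close>.\<close>

lemma infinite_energy_imp: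
  fixes u v p \<beta> \<mu> :: "nat \<Rightarrow> real"
  assumes \<beta>: "\<And>n. 0 < \<beta> n" and \<mu>: "\<And>n. 0 < \<mu> n"
    and u: "summable (\<lambda>n. (u n)\<^sup>2 * \<mu> n)"
    and uv: "summable (\<lambda>n. \<bar>u n * v n * \<mu> n\<bar>)"
    and p: "\<And>n. p n = \<beta> n * (u (Suc n) - u n)"
    and v0: "v 0 * \<mu> 0 = - p 0"
    and v: "\<And>n. v (Suc n) * \<mu> (Suc n) = p n - p (Suc n)"
    and E: "\<not> summable (\<lambda>n. \<beta> n * (u (Suc n) - u n)\<^sup>2)"
  shows "summable (\<lambda>n. (\<Sum>k<n. 1 / \<beta> k)\<^sup>2 * \<mu> n)"
proof -
  define C where "C = (\<Sum>n. \<bar>u n * v n * \<mu> n\<bar>)"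
  have C: "(\<Sum>k<n. \<bar>u k * v k * \<mu> k\<bar>) \<le> C" for n
    unfolding C_def by (intro sum_le_suminf uv) auto
  \<comment> \<open>By \<open>v0\<close> no flux enters at the first vertex, so the left end
    contributes no boundary term.\<close>
  have green: "(\<Sum>k<Suc n. u k * v k * \<mu> k) = (\<Sum>k<n. \<beta> k * (u (Suc k) - u k)\<^sup>2) - p n * u n" for n
  proof (induction n)
    case 0
    then show ?case using v0 by (simp add: mult.assoc)
  next
    case (Suc n)
    have "u (Suc n) * v (Suc n) * \<mu> (Suc n) = u (Suc n) * (p n - p (Suc n))"
      using v[of n] by (simp add: mult.assoc)
    with Suc show ?case by (simp add: p power2_eq_square algebra_simps)
  qed
  have "\<exists>N. \<forall>n\<ge>N. C + 1 \<le> p n * u n"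
  proof -
    \<comment> \<open>The sum in Green's formula may cost up to \<open>C\<close>, so an energy above
      \<open>2 * C + 1\<close> leaves \<open>C + 1\<close>.\<close>
    have "\<not> (\<forall>n. (\<Sum>k<n. \<beta> k * (u (Suc k) - u k)\<^sup>2) \<le> 2 * C + 1)"
      using E \<beta> summableI_nonneg_bounded[of "\<lambda>n. \<beta> n * (u (Suc n) - u n)\<^sup>2" "2 * C + 1"]
      by (auto simp: less_imp_le)
    then obtain N where N: "2 * C + 1 < (\<Sum>k<N. \<beta> k * (u (Suc k) - u k)\<^sup>2)"
      by (auto simp: not_le)
    have "C + 1 \<le> p n * u n" if "N \<le> n" for n
    proof -
      have "(\<Sum>k<N. \<beta> k * (u (Suc k) - u k)\<^sup>2) \<le> (\<Sum>k<n. \<beta> k * (u (Suc k) - u k)\<^sup>2)"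
        using that \<beta> by (intro sum_mono2) (auto simp: less_imp_le)
      moreover have "\<bar>\<Sum>k<Suc n. u k * v k * \<mu> k\<bar> \<le> C"
        using sum_abs[of "\<lambda>k. u k * v k * \<mu> k" "{..<Suc n}"] C[of "Suc n"] by linarith
      ultimately show ?thesis using N green[of n] by linarith
    qed
    then show ?thesis by blast
  qed
  then obtain N where N: "\<And>n. N \<le> n \<Longrightarrow> C + 1 \<le> p n * u n" by blast
  have "0 \<le> C" using C[of 0] by simp
  then have "u N \<noteq> 0" using N[of N] by auto
  then consider "0 < u N" | "0 < - u N" by linarith
  then show ?thesis
  proof cases
    case 1
    show ?thesis
      by (rule unbounded_energy_growth[OF \<beta> \<mu> u p v C N 1])
  next
    case 2
    \<comment> \<open>Negating \<open>u\<close>, \<open>p\<close> and \<open>v\<close> together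
      preserves every hypothesis.\<close>
    show ?thesis
      by (rule unbounded_energy_growth[of \<beta> \<mu> "\<lambda>n. - u n" "\<lambda>n. - p n" "\<lambda>n. - v n" C N])
        (use \<beta> \<mu> u p v C N 2 in \<open>simp_all add: algebra_simps\<close>)
  qed
qed

section \<open>Square-summability of affine functions of a sequence tending to infinity or to
  zero\<close>

lemma filterlim_partial_sums_at_top:
  fixes \<sigma> :: "nat \<Rightarrow> real"
  assumes \<sigma>: "\<And>n. 0 \<le> \<sigma> n" and ns: "\<not> summable \<sigma>"
  shows "filterlim (\<lambda>n. \<Sum>k<n. \<sigma> k) at_top sequentially"
  unfolding filterlim_at_top
proof
  fix Z
  have "\<not> (\<forall>n. (\<Sum>k<n. \<sigma> k) \<le> Z)"
    using ns \<sigma> summableI_nonneg_bounded[of \<sigma> Z] by blast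
  then obtain N where N: "Z < (\<Sum>k<N. \<sigma> k)" by (auto simp: not_le)
  have "Z \<le> (\<Sum>k<n. \<sigma> k)" if "N \<le> n" for n
    using N sum_mono2[of "{..<n}" "{..<N}" \<sigma>] that \<sigma> by auto
  then show "\<forall>\<^sub>F n in sequentially. Z \<le> (\<Sum>k<n. \<sigma> k)"
    by (auto simp: eventually_sequentially)
qed

lemma summable_square_comparison:
  fixes f g \<mu> :: "nat \<Rightarrow> real"
  assumes le: "\<forall>\<^sub>F n in sequentially. \<bar>f n\<bar> \<le> K * \<bar>g n\<bar>"
    and \<mu>: "\<And>n. 0 \<le> \<mu> n" and g: "summable (\<lambda>n. (g n)\<^sup>2 * \<mu> n)"
  shows "summable (\<lambda>n. (f n)\<^sup>2 * \<mu> n)"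
proof (rule summable_comparison_test_ev)
  show "summable (\<lambda>n. K\<^sup>2 * ((g n)\<^sup>2 * \<mu> n))" by (intro summable_mult g)
  show "\<forall>\<^sub>F n in sequentially. norm ((f n)\<^sup>2 * \<mu> n) \<le> K\<^sup>2 * ((g n)\<^sup>2 * \<mu> n)"
    using le
  proof eventually_elim
    case (elim n)
    have "\<bar>f n\<bar>\<^sup>2 \<le> (K * \<bar>g n\<bar>)\<^sup>2" using elim by (rule power_mono) simp
    then show ?case
      using mult_right_mono[of "(f n)\<^sup>2" "K\<^sup>2 * (g n)\<^sup>2" "\<mu> n"] \<mu>[of n]
      by (simp add: power_mult_distrib mult.assoc)
  qed
qed

text \<open>Once \<open>S n \<ge> 2 * \<bar>a\<bar> / \<bar>c\<bar>\<close>, the constant is at most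
  half of the growing term, so \<open>\<bar>a + c * S n\<bar>\<close> and \<open>S n\<close> bound
  each other up to a factor.\<close>

lemma summable_affine_at_top_iff:
  fixes S \<mu> :: "nat \<Rightarrow> real"
  assumes S: "filterlim S at_top sequentially" and \<mu>: "\<And>n. 0 \<le> \<mu> n" and c: "c \<noteq> 0"
  shows "summable (\<lambda>n. (a + c * S n)\<^sup>2 * \<mu> n) \<longleftrightarrow> summable (\<lambda>n. (S n)\<^sup>2 * \<mu> n)"
proof
  \<comment> \<open>The entry \<open>1\<close> in the maximum keeps \<open>S n\<close> positive also
    when \<open>a = 0\<close>.\<close>
  have ev: "\<forall>\<^sub>F n in sequentially. max 1 (2 * \<bar>a\<bar> / \<bar>c\<bar>) \<le> S n"
    using S by (simp only: filterlim_at_top)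
  have big: "\<bar>a\<bar> \<le> \<bar>c\<bar> * S n / 2 \<and> 1 \<le> S n" if "max 1 (2 * \<bar>a\<bar> / \<bar>c\<bar>) \<le> S n" for n
    using that c by (auto simp: field_simps)
  show "summable (\<lambda>n. (S n)\<^sup>2 * \<mu> n)" if "summable (\<lambda>n. (a + c * S n)\<^sup>2 * \<mu> n)"
  proof (rule summable_square_comparison[OF _ \<mu> that])
    show "\<forall>\<^sub>F n in sequentially. \<bar>S n\<bar> \<le> 2 / \<bar>c\<bar> * \<bar>a + c * S n\<bar>"
      using ev
    proof eventually_elim
      case (elim n)
      have "\<bar>c\<bar> * S n = \<bar>c * S n\<bar>" using big[OF elim] by (simp add: abs_mult)
      then have "\<bar>c\<bar> * S n / 2 \<le> \<bar>a + c * S n\<bar>" using big[OF elim] by linarith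
      then show ?case using c big[OF elim] by (simp add: field_simps)
    qed
  qed
  show "summable (\<lambda>n. (a + c * S n)\<^sup>2 * \<mu> n)" if "summable (\<lambda>n. (S n)\<^sup>2 * \<mu> n)"
  proof (rule summable_square_comparison[OF _ \<mu> that])
    show "\<forall>\<^sub>F n in sequentially. \<bar>a + c * S n\<bar> \<le> 2 * \<bar>c\<bar> * \<bar>S n\<bar>"
      using ev
    proof eventually_elim
      case (elim n)
      have "\<bar>c\<bar> * S n = \<bar>c * S n\<bar>" "0 \<le> \<bar>c\<bar> * S n" using big[OF elim] by (simp_all add: abs_mult)
      then have "\<bar>a + c * S n\<bar> \<le> 2 * (\<bar>c\<bar> * S n)" using big[OF elim] by linarith
      then show ?case using big[OF elim] by simp
    qed
  qed
qed

text \<open>Eventually \<open>\<bar>c * T n\<bar>\<close> is below \<open>\<bar>a\<bar> / 2\<close>,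
  so the affine function is comparable to the constant \<open>1\<close>.\<close>

lemma summable_affine_at_zero_iff:
  fixes T \<mu> :: "nat \<Rightarrow> real"
  assumes T: "T \<longlonglongrightarrow> 0" and \<mu>: "\<And>n. 0 \<le> \<mu> n" and a: "a \<noteq> 0"
  shows "summable (\<lambda>n. (a + c * T n)\<^sup>2 * \<mu> n) \<longleftrightarrow> summable \<mu>"
proof
  have "(\<lambda>n. c * T n) \<longlonglongrightarrow> 0" using tendsto_mult_left[OF T, of c] by simp
  then have ev: "\<forall>\<^sub>F n in sequentially. \<bar>c * T n\<bar> < \<bar>a\<bar> / 2"
    using a by (intro order_tendstoD(2)[OF tendsto_rabs_zero]) auto
  show "summable \<mu>" if "summable (\<lambda>n. (a + c * T n)\<^sup>2 * \<mu> n)"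
  proof -
    have "summable (\<lambda>n. 1\<^sup>2 * \<mu> n)"
    proof (rule summable_square_comparison[OF _ \<mu> that])
      show "\<forall>\<^sub>F n in sequentially. \<bar>1\<bar> \<le> 2 / \<bar>a\<bar> * \<bar>a + c * T n\<bar>"
        using ev
      proof eventually_elim
        case (elim n)
        then have "\<bar>a\<bar> / 2 \<le> \<bar>a + c * T n\<bar>" by linarith
        then show ?case using a by (simp add: field_simps)
      qed
    qed
    then show ?thesis by simp
  qed
  show "summable (\<lambda>n. (a + c * T n)\<^sup>2 * \<mu> n)" if "summable \<mu>"
  proof (rule summable_square_comparison[OF _ \<mu>])
    show "summable (\<lambda>n. 1\<^sup>2 * \<mu> n)" using that by simp
    show "\<forall>\<^sub>F n in sequentially. \<bar>a + c * T n\<bar> \<le> 2 * \<bar>a\<bar> * \<bar>1\<bar>"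
      using ev by eventually_elim (use a in linarith)
  qed
qed

lemma int_function_constant:
  fixes g :: "int \<Rightarrow> 'a"
  assumes "\<And>x. g (x + 1) = g x"
  shows "g x = g 0"
proof (induction x rule: int_induct[where k = 0])
  case (step2 i)
  then show ?case using assms[of "i - 1"] by simp
qed (simp_all add: assms)

section \<open>Weighted square-summable functions and self-adjoint extensions\<close>

lemma wl2_mult_summable:
  assumes m: "\<And>x. 0 < m x" and f: "f \<in> wl2 V m" and g: "g \<in> wl2 V m"
  shows "(\<lambda>x. \<bar>f x * g x * m x\<bar>) summable_on V"
proof (rule summable_on_comparison_test)
  show "(\<lambda>x. (f x)\<^sup>2 * m x + (g x)\<^sup>2 * m x) summable_on V"
    using f g by (intro summable_on_add) (auto simp: wl2_def)
  fix x
  have "\<bar>f x * g x\<bar> \<le> (f x)\<^sup>2 + (g x)\<^sup>2"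
    using sum_squares_bound[of "\<bar>f x\<bar>" "\<bar>g x\<bar>"] abs_ge_zero[of "f x * g x"]
    unfolding abs_mult power2_abs by linarith
  then have "\<bar>f x * g x\<bar> * m x \<le> ((f x)\<^sup>2 + (g x)\<^sup>2) * m x"
    using m[of x] by (intro mult_right_mono) auto
  then show "\<bar>f x * g x * m x\<bar> \<le> (f x)\<^sup>2 * m x + (g x)\<^sup>2 * m x"
    using m[of x] by (simp add: abs_mult algebra_simps)
qed auto

lemma wl2_mult_summable_on:
  assumes "\<And>x. 0 < m x" "f \<in> wl2 V m" "g \<in> wl2 V m"
  shows "(\<lambda>x. f x * g x * m x) summable_on V"
  using wl2_mult_summable[OF assms] by (subst summable_on_iff_abs_summable_on_real) simp

lemma wl2_add:
  assumes m: "\<And>x. 0 < m x" and f: "f \<in> wl2 V m" and g: "g \<in> wl2 V m"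
  shows "(\<lambda>x. f x + g x) \<in> wl2 V m"
proof -
  have "(\<lambda>x. (f x)\<^sup>2 * m x + (2 * (f x * g x * m x) + (g x)\<^sup>2 * m x)) summable_on V"
    using f g by (intro summable_on_add summable_on_cmult_right wl2_mult_summable_on m) (auto simp: wl2_def)
  then show ?thesis
    using f g by (auto simp: wl2_def power2_eq_square algebra_simps)
qed

lemma wl2_scale:
  assumes "f \<in> wl2 V m"
  shows "(\<lambda>x. c * f x) \<in> wl2 V m"
proof -
  have "(\<lambda>x. c\<^sup>2 * ((f x)\<^sup>2 * m x)) summable_on V"
    using assms by (intro summable_on_cmult_right) (auto simp: wl2_def)
  then show ?thesis
    using assms by (auto simp: wl2_def power_mult_distrib mult.assoc)
qed

lemma wl2_finite_support:
  assumes "finite {x. f x \<noteq> 0}" "{x. f x \<noteq> 0} \<subseteq> V"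
  shows "f \<in> wl2 V m"
proof -
  have "(\<lambda>x. (f x)\<^sup>2 * m x) summable_on {x. f x \<noteq> 0}" using assms by simp
  then have "(\<lambda>x. (f x)\<^sup>2 * m x) summable_on V"
    by (rule summable_on_cong_neutral[THEN iffD1, rotated -1]) (use assms in auto)
  then show ?thesis using assms by (auto simp: wl2_def)
qed

lemma wl2_inner_commute: "wl2_inner V m f g = wl2_inner V m g f"
  by (simp add: wl2_inner_def mult.commute)

lemma wl2_inner_add_left:
  assumes "\<And>x. 0 < m x" "f \<in> wl2 V m" "g \<in> wl2 V m" "h \<in> wl2 V m"
  shows "wl2_inner V m (\<lambda>x. f x + g x) h = wl2_inner V m f h + wl2_inner V m g h"
  unfolding wl2_inner_def distrib_right
  by (intro infsum_add wl2_mult_summable_on assms)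

lemma wl2_inner_scale_left: "wl2_inner V m (\<lambda>x. c * f x) h = c * wl2_inner V m f h"
  by (simp add: wl2_inner_def mult.assoc infsum_cmult_right')

text \<open>Truncate \<open>f\<close> to a finite set that misses at most
  \<open>\<epsilon>\<^sup>2 / 2\<close> of the series; the factor one half yields the strict
  inequality.\<close>

lemma finite_support_dense:
  assumes m: "\<And>x. 0 < m x" and f: "f \<in> wl2 V m" and \<epsilon>: "0 < \<epsilon>"
  shows "\<exists>h. finite {x. h x \<noteq> 0} \<and> {x. h x \<noteq> 0} \<subseteq> V \<and> wl2_norm V m (\<lambda>x. f x - h x) < \<epsilon>"
proof -
  let ?q = "\<lambda>x. (f x)\<^sup>2 * m x"
  have q: "?q summable_on V" using f by (simp add: wl2_def)
  obtain F where F: "finite F" "F \<subseteq> V" "dist (sum ?q F) (infsum ?q V) \<le> \<epsilon>\<^sup>2 / 2"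
    using infsum_finite_approximation[OF q, of "\<epsilon>\<^sup>2 / 2"] \<epsilon> by auto
  define h where "h x = (if x \<in> F then f x else 0)" for x
  have "wl2_inner V m (\<lambda>x. f x - h x) (\<lambda>x. f x - h x) = infsum ?q (V - F)"
    unfolding wl2_inner_def
    by (rule infsum_cong_neutral) (auto simp: h_def power2_eq_square)
  also have "\<dots> = infsum ?q V - sum ?q F"
    using F q by (subst infsum_Diff) auto
  also have "\<dots> < \<epsilon>\<^sup>2"
    using F(3) zero_less_power[OF \<epsilon>, of 2] unfolding dist_real_def by linarith
  finally have "wl2_norm V m (\<lambda>x. f x - h x) < \<epsilon>"
    unfolding wl2_norm_def using \<epsilon> real_less_lsqrt[of \<epsilon>] by simp
  moreover have "{x. h x \<noteq> 0} \<subseteq> F" by (auto simp: h_def)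
  ultimately show ?thesis using F finite_subset by blast
qed

section \<open>Symmetry defect of an operator and uniqueness of self-adjoint extensions\<close>

definition boundary_form ::
    "'a set \<Rightarrow> ('a \<Rightarrow> real) \<Rightarrow> ('a \<Rightarrow> real) \<times> ('a \<Rightarrow> real) \<Rightarrow> ('a \<Rightarrow> real) \<times> ('a \<Rightarrow> real) \<Rightarrow> real" where
  "boundary_form V m p q = wl2_inner V m (snd p) (fst q) - wl2_inner V m (fst p) (snd q)"

text \<open>The adjoint is the annihilator of the graph under the boundary form, so a self-adjoint
  graph is its own annihilator.\<close>

lemma adjoint_op_iff:
  "q \<in> adjoint_op V m T \<longleftrightarrow>
     q \<in> wl2 V m \<times> wl2 V m \<and> (\<forall>p\<in>T. boundary_form V m p q = 0)"
  by (cases q) (auto simp: adjoint_op_def boundary_form_def)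

lemma adjoint_op_antimono: "S \<subseteq> T \<Longrightarrow> adjoint_op V m T \<subseteq> adjoint_op V m S"
  by (auto simp: adjoint_op_def)

lemma boundary_form_swap: "boundary_form V m q p = - boundary_form V m p q"
  using wl2_inner_commute[of V m "fst p" "snd q"] wl2_inner_commute[of V m "snd p" "fst q"]
  by (simp add: boundary_form_def)

lemma densely_defined_mono: "densely_defined V m T \<Longrightarrow> T \<subseteq> A \<Longrightarrow> densely_defined V m A"
  unfolding densely_defined_def by (meson Domain_mono subsetD)

text \<open>Write \<open>M\<close> for the adjoint. Symmetry puts \<open>M\<close> into its own
  adjoint, and \<open>T \<subseteq> M\<close> gives the reverse inclusion. A self-adjoint
  \<open>A\<close> above \<open>T\<close> lies in \<open>M\<close>, and taking adjoints once more
  yields \<open>M \<subseteq> A\<close>.\<close>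

lemma essentially_self_adjointI:
  assumes lin: "linear_op V m (adjoint_op V m T)" and dd: "densely_defined V m T"
    and T: "T \<subseteq> adjoint_op V m T"
    and sym: "\<And>p q. p \<in> adjoint_op V m T \<Longrightarrow> q \<in> adjoint_op V m T \<Longrightarrow> boundary_form V m p q = 0"
  shows "essentially_self_adjoint V m T"
proof -
  let ?M = "adjoint_op V m T"
  have M: "adjoint_op V m ?M = ?M"
  proof
    show "adjoint_op V m ?M \<subseteq> ?M" by (rule adjoint_op_antimono[OF T])
    show "?M \<subseteq> adjoint_op V m ?M"
      using lin sym by (auto simp: adjoint_op_iff[of _ V m ?M] linear_op_def)
  qed
  then have "self_adjoint V m ?M"
    using lin densely_defined_mono[OF dd T] by (simp add: self_adjoint_def)
  moreover have "A = ?M" if "self_adjoint V m A" "T \<subseteq> A" for A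
  proof -
    have A: "adjoint_op V m A = A" using that by (simp add: self_adjoint_def)
    then have "A \<subseteq> ?M" using adjoint_op_antimono[OF that(2)] by metis
    then show ?thesis using adjoint_op_antimono[of A ?M V m] A M by auto
  qed
  ultimately show ?thesis unfolding essentially_self_adjoint_def using T by blast
qed

text \<open>If the boundary form of the adjoint behaves like a nonzero Wronskian, then vanishing of
  the form against a fixed \<open>\<phi>\<close> is a self-adjoint boundary condition.\<close>

lemma self_adjoint_boundary_condition:
  assumes m: "\<And>x. 0 < m x"
    and lin: "linear_op V m (adjoint_op V m T)" and dd: "densely_defined V m T"
    and T: "T \<subseteq> adjoint_op V m T"
    and \<phi>: "\<phi> \<in> adjoint_op V m T" and nz: "boundary_form V m \<phi> \<psi> \<noteq> 0"
    and pl: "\<And>p q. p \<in> adjoint_op V m T \<Longrightarrow> q \<in> adjoint_op V m T \<Longrightarrow>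
      boundary_form V m p q * boundary_form V m \<phi> \<psi> =
      boundary_form V m p \<phi> * boundary_form V m q \<psi> - boundary_form V m p \<psi> * boundary_form V m q \<phi>"
  defines "A \<equiv> {p \<in> adjoint_op V m T. boundary_form V m p \<phi> = 0}"
  shows "self_adjoint V m A" "T \<subseteq> A"
proof -
  show TA: "T \<subseteq> A" using T \<phi> by (auto simp: A_def adjoint_op_iff[of \<phi>])
  have AM: "A \<subseteq> adjoint_op V m T" by (auto simp: A_def)
  have \<phi>W: "fst \<phi> \<in> wl2 V m" "snd \<phi> \<in> wl2 V m" using \<phi> by (auto simp: adjoint_op_iff mem_Times_iff)
  have "linear_op V m A"
    unfolding linear_op_def
  proof (intro conjI allI impI)
    show "A \<subseteq> wl2 V m \<times> wl2 V m" using AM lin by (auto simp: linear_op_def)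
    show "single_valued A" using AM lin by (auto simp: linear_op_def intro: single_valued_subset)
    show "(\<lambda>x. 0, \<lambda>x. 0) \<in> A"
      using lin by (simp add: A_def linear_op_def boundary_form_def wl2_inner_def)
    fix f g assume fg: "(f, g) \<in> A"
    show "(\<lambda>x. c * f x, \<lambda>x. c * g x) \<in> A" for c
      using fg lin by (auto simp: A_def linear_op_def boundary_form_def wl2_inner_scale_left
          simp flip: right_diff_distrib)
    fix f' g' assume fg': "(f', g') \<in> A"
    have "f \<in> wl2 V m" "g \<in> wl2 V m" "f' \<in> wl2 V m" "g' \<in> wl2 V m"
      using fg fg' AM lin by (auto simp: linear_op_def)
    then show "(\<lambda>x. f x + f' x, \<lambda>x. g x + g' x) \<in> A"
      using fg fg' lin \<phi>W by (auto simp: A_def linear_op_def boundary_form_def wl2_inner_add_left[OF m])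
  qed
  moreover have "adjoint_op V m A = A"
  proof
    show "A \<subseteq> adjoint_op V m A"
    proof
      fix q assume q: "q \<in> A"
      \<comment> \<open>Both products on the right of \<open>pl\<close> contain a factor that
        vanishes by the boundary condition.\<close>
      have "boundary_form V m p q = 0" if "p \<in> A" for p
        using pl[of p q] that q nz by (auto simp: A_def)
      then show "q \<in> adjoint_op V m A" using q by (auto simp: A_def adjoint_op_iff)
    qed
    show "adjoint_op V m A \<subseteq> A"
    proof
      fix q assume q: "q \<in> adjoint_op V m A"
      \<comment> \<open>Skew-symmetry makes \<open>\<phi>\<close> satisfy its own condition, so it
        may serve as a test element for the adjoint of \<open>A\<close>.\<close>
      have "boundary_form V m \<phi> \<phi> = 0" using boundary_form_swap[of V m \<phi> \<phi>] by simp
      then have "\<phi> \<in> A" using \<phi> by (simp add: A_def)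
      then have "boundary_form V m \<phi> q = 0" using q by (simp add: adjoint_op_iff)
      then have "boundary_form V m q \<phi> = 0" using boundary_form_swap[of V m q \<phi>] by simp
      then show "q \<in> A" using adjoint_op_antimono[OF TA] q by (auto simp: A_def)
    qed
  qed
  ultimately show "self_adjoint V m A"
    using densely_defined_mono[OF dd TA] by (simp add: self_adjoint_def)
qed

text \<open>The conditions against \<open>\<phi>\<close> and against \<open>\<psi>\<close> both give
  self-adjoint extensions. Were these equal, \<open>\<phi>\<close> would satisfy the condition of
  \<open>\<psi>\<close>, contradicting \<open>nz\<close>. Assumption \<open>pl\<close> is a Pluecker
  relation: the form depends only on the two boundary values against \<open>\<phi>\<close> and
  \<open>\<psi>\<close>.\<close>

lemma not_essentially_self_adjointI:
  assumes m: "\<And>x. 0 < m x"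
    and lin: "linear_op V m (adjoint_op V m T)" and dd: "densely_defined V m T"
    and T: "T \<subseteq> adjoint_op V m T"
    and \<phi>: "\<phi> \<in> adjoint_op V m T" and \<psi>: "\<psi> \<in> adjoint_op V m T"
    and nz: "boundary_form V m \<phi> \<psi> \<noteq> 0"
    and pl: "\<And>p q. p \<in> adjoint_op V m T \<Longrightarrow> q \<in> adjoint_op V m T \<Longrightarrow>
      boundary_form V m p q * boundary_form V m \<phi> \<psi> =
      boundary_form V m p \<phi> * boundary_form V m q \<psi> - boundary_form V m p \<psi> * boundary_form V m q \<phi>"
  shows "\<not> essentially_self_adjoint V m T"
proof
  let ?A = "\<lambda>\<eta>. {p \<in> adjoint_op V m T. boundary_form V m p \<eta> = 0}"
  assume "essentially_self_adjoint V m T"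
  moreover have "self_adjoint V m (?A \<phi>)" "T \<subseteq> ?A \<phi>"
    using self_adjoint_boundary_condition[OF m lin dd T \<phi> nz pl] by blast+
  moreover have "self_adjoint V m (?A \<psi>)" "T \<subseteq> ?A \<psi>"
  proof -
    have nz': "boundary_form V m \<psi> \<phi> \<noteq> 0" using nz boundary_form_swap[of V m \<psi> \<phi>] by simp
    \<comment> \<open>Exchanging \<open>\<phi>\<close> and \<open>\<psi>\<close> reverses the sign
      of both sides of \<open>pl\<close>.\<close>
    have "boundary_form V m p q * boundary_form V m \<psi> \<phi> =
      boundary_form V m p \<psi> * boundary_form V m q \<phi> - boundary_form V m p \<phi> * boundary_form V m q \<psi>"
      if "p \<in> adjoint_op V m T" "q \<in> adjoint_op V m T" for p q
      using pl[OF that] boundary_form_swap[of V m \<psi> \<phi>] by simp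
    from self_adjoint_boundary_condition[OF m lin dd T \<psi> nz' this]
    show "self_adjoint V m (?A \<psi>)" "T \<subseteq> ?A \<psi>" by blast+
  qed
  ultimately have "?A \<phi> = ?A \<psi>" unfolding essentially_self_adjoint_def by blast
  moreover have "\<phi> \<in> ?A \<phi>" using \<phi> boundary_form_swap[of V m \<phi> \<phi>] by simp
  ultimately show False using nz by blast
qed

section \<open>The Laplacian on the positive ray\<close>

text \<open>The ray is renumbered from \<open>0\<close>, with index \<open>n\<close> standing for
  vertex \<open>n + 1\<close>, so that the facts about sequences apply.\<close>

definition ray_seq :: "(int \<Rightarrow> 'a) \<Rightarrow> nat \<Rightarrow> 'a" where
  "ray_seq f n = f (int n + 1)"

definition ray_edge :: "(int \<Rightarrow> int \<Rightarrow> real) \<Rightarrow> nat \<Rightarrow> real" where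
  "ray_edge b n = b (int n + 1) (int n + 2)"

definition ray_flux :: "(int \<Rightarrow> int \<Rightarrow> real) \<Rightarrow> (int \<Rightarrow> real) \<Rightarrow> nat \<Rightarrow> real" where
  "ray_flux b f n = ray_edge b n * (ray_seq f (Suc n) - ray_seq f n)"

definition ray_extend :: "(nat \<Rightarrow> real) \<Rightarrow> int \<Rightarrow> real" where
  "ray_extend s x = (if 1 \<le> x then s (nat (x - 1)) else 0)"

lemma ray_seq_extend [simp]: "ray_seq (ray_extend s) = s"
  by (simp add: ray_seq_def ray_extend_def fun_eq_iff)

lemma bij_betw_ray: "bij_betw (\<lambda>n. int n + 1) UNIV {1..}"
  by (rule bij_betwI[where g = "\<lambda>x. nat (x - 1)"]) auto

lemma ray_eqI:
  assumes "\<And>n. ray_seq f n = ray_seq g n" and "\<And>x. x < 1 \<Longrightarrow> f x = g x"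
  shows "f = g"
proof
  fix x :: int
  show "f x = g x"
    using assms(1)[of "nat (x - 1)"] assms(2)[of x] by (cases "x < 1") (auto simp: ray_seq_def)
qed

locale star =
  fixes b :: "int \<Rightarrow> int \<Rightarrow> real" and m :: "int \<Rightarrow> real"
  assumes star: "star_two_rays b m"
begin

lemma m_pos: "0 < m x"
  using star by (simp add: star_two_rays_def)

lemma b_sym: "b x y = b y x"
  using star by (simp add: star_two_rays_def)

lemma b_pos: "\<bar>x - y\<bar> = 1 \<Longrightarrow> 0 < b x y"
  using star by (simp add: star_two_rays_def)

lemma b_zero: "\<bar>x - y\<bar> \<noteq> 1 \<Longrightarrow> b x y = 0"
  using star unfolding star_two_rays_def by (metis order_le_less)

lemma ray_edge_pos: "0 < ray_edge b n"
  by (simp add: ray_edge_def b_pos)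

lemma ray_m_pos: "0 < ray_seq m n"
  by (simp add: ray_seq_def m_pos)

text \<open>\<open>b\<close> vanishes between non-neighbours. Intersecting with \<open>V\<close>
  serves the line, the interior of the ray and its end vertex alike.\<close>

lemma laplacian_eq:
  "formal_laplacian V b m f x =
     (if x \<in> V then (1 / m x) * (\<Sum>y\<in>V \<inter> {x - 1, x + 1}. b x y * (f x - f y)) else 0)"
proof -
  have "(\<Sum>\<^sub>\<infinity>y\<in>V. b x y * (f x - f y)) = (\<Sum>\<^sub>\<infinity>y\<in>V \<inter> {x - 1, x + 1}. b x y * (f x - f y))"
  proof (rule infsum_cong_neutral)
    fix y assume "y \<in> V - V \<inter> {x - 1, x + 1}"
    then have "\<bar>x - y\<bar> \<noteq> 1" by auto
    then show "b x y * (f x - f y) = 0" by (simp add: b_zero)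
  qed auto
  then show ?thesis by (simp add: formal_laplacian_def)
qed

lemma laplacian_add:
  "formal_laplacian V b m (\<lambda>x. f x + g x) = (\<lambda>x. formal_laplacian V b m f x + formal_laplacian V b m g x)"
proof
  fix x
  have "(\<Sum>y\<in>V \<inter> {x - 1, x + 1}. b x y * ((f x + g x) - (f y + g y))) =
    (\<Sum>y\<in>V \<inter> {x - 1, x + 1}. b x y * (f x - f y)) + (\<Sum>y\<in>V \<inter> {x - 1, x + 1}. b x y * (g x - g y))"
    unfolding sum.distrib[symmetric] by (rule sum.cong) (auto simp: algebra_simps)
  then show "formal_laplacian V b m (\<lambda>x. f x + g x) x = formal_laplacian V b m f x + formal_laplacian V b m g x"
    by (simp only: laplacian_eq distrib_left if_distrib) simp
qed

lemma laplacian_scale: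
  "formal_laplacian V b m (\<lambda>x. c * f x) = (\<lambda>x. c * formal_laplacian V b m f x)"
proof
  fix x
  have "(\<Sum>y\<in>V \<inter> {x - 1, x + 1}. b x y * (c * f x - c * f y)) =
    c * (\<Sum>y\<in>V \<inter> {x - 1, x + 1}. b x y * (f x - f y))"
    unfolding sum_distrib_left by (rule sum.cong) (auto simp: algebra_simps)
  then show "formal_laplacian V b m (\<lambda>x. c * f x) x = c * formal_laplacian V b m f x"
    by (simp only: laplacian_eq) simp
qed

abbreviation ray_lap :: "(int \<Rightarrow> real) \<Rightarrow> int \<Rightarrow> real" where
  "ray_lap \<equiv> formal_laplacian {1..} b m"

lemma ray_lap_outside: "x < 1 \<Longrightarrow> ray_lap f x = 0"
  by (simp add: formal_laplacian_def)

text \<open>The induced subgraph lacks the edge to \<open>0\<close>, so vertex \<open>1\<close>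
  keeps only the neighbour \<open>2\<close>: a Neumann condition at the end.\<close>

lemma ray_lap_0: "ray_seq (ray_lap f) 0 * ray_seq m 0 = - ray_flux b f 0"
proof -
  have "{1..} \<inter> {1 - 1, 1 + 1} = {2::int}" by auto
  then show ?thesis
    using m_pos[of 1]
    by (simp add: ray_seq_def ray_flux_def ray_edge_def laplacian_eq algebra_simps)
qed

lemma ray_lap_Suc:
  "ray_seq (ray_lap f) (Suc n) * ray_seq m (Suc n) = ray_flux b f n - ray_flux b f (Suc n)"
proof -
  define x where "x = int n + 2"
  have "{1..} \<inter> {x - 1, x + 1} = {x - 1, x + 1}" by (auto simp: x_def)
  moreover have "x - 1 \<noteq> x + 1" by simp
  ultimately have "ray_lap f x * m x = b x (x - 1) * (f x - f (x - 1)) + b x (x + 1) * (f x - f (x + 1))"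
    using m_pos[of x] by (simp add: laplacian_eq x_def)
  then show ?thesis
    by (simp add: x_def ray_seq_def ray_flux_def ray_edge_def b_sym[of "1 + int n" "int n + 2"] algebra_simps)
qed

text \<open>Summation by parts: interior Wronskians telescope and the end vertex contributes none,
  so only the one at the last edge remains.\<close>

lemma ray_green:
  "(\<Sum>k<Suc n. (ray_seq (ray_lap f) k * ray_seq u k - ray_seq f k * ray_seq (ray_lap u) k) * ray_seq m k) =
     ray_edge b n * (ray_seq f n * ray_seq u (Suc n) - ray_seq f (Suc n) * ray_seq u n)"
proof (induction n)
  case 0
  show ?case
    using ray_lap_0[of f] ray_lap_0[of u] unfolding ray_flux_def by (simp, algebra)
next
  case (Suc n)
  show ?case
    using Suc ray_lap_Suc[of f n] ray_lap_Suc[of u n] unfolding ray_flux_def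
    by (simp only: sum.lessThan_Suc[of _ "Suc n"], algebra)
qed

section \<open>Square-summable and finitely supported functions on the ray\<close>

lemma wl2_ray_iff:
  "f \<in> wl2 {1..} m \<longleftrightarrow> (\<forall>x<1. f x = 0) \<and> summable (\<lambda>n. (ray_seq f n)\<^sup>2 * ray_seq m n)"
proof -
  have "(\<lambda>x. (f x)\<^sup>2 * m x) summable_on {1..} \<longleftrightarrow> (\<lambda>n. (ray_seq f n)\<^sup>2 * ray_seq m n) summable_on UNIV"
    unfolding ray_seq_def
    by (rule summable_on_reindex_bij_betw[OF bij_betw_ray, of "\<lambda>x. (f x)\<^sup>2 * m x", symmetric])
  also have "\<dots> \<longleftrightarrow> summable (\<lambda>n. (ray_seq f n)\<^sup>2 * ray_seq m n)"
    by (rule summable_on_UNIV_nonneg_real_iff) (simp add: ray_m_pos less_imp_le)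
  finally show ?thesis by (auto simp: wl2_def not_le)
qed

lemma wl2_inner_ray:
  "wl2_inner {1..} m f g = (\<Sum>\<^sub>\<infinity>n. ray_seq f n * ray_seq g n * ray_seq m n)"
  unfolding wl2_inner_def ray_seq_def
  by (rule infsum_reindex_bij_betw[OF bij_betw_ray, of "\<lambda>x. f x * g x * m x", symmetric])

lemma ray_mult_summable_on:
  assumes "f \<in> wl2 {1..} m" "g \<in> wl2 {1..} m"
  shows "(\<lambda>n. \<bar>ray_seq f n * ray_seq g n * ray_seq m n\<bar>) summable_on UNIV"
  using wl2_mult_summable[OF m_pos assms]
    summable_on_reindex_bij_betw[OF bij_betw_ray, of "\<lambda>x. \<bar>f x * g x * m x\<bar>"]
  by (simp add: ray_seq_def)

lemma wl2_inner_ray_sums: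
  assumes "f \<in> wl2 {1..} m" "g \<in> wl2 {1..} m"
  shows "(\<lambda>n. ray_seq f n * ray_seq g n * ray_seq m n) sums wl2_inner {1..} m f g"
proof -
  have "(\<lambda>n. ray_seq f n * ray_seq g n * ray_seq m n) summable_on UNIV"
    using ray_mult_summable_on[OF assms] by (subst summable_on_iff_abs_summable_on_real) simp
  then show ?thesis
    unfolding wl2_inner_ray by (intro has_sum_imp_sums has_sum_infsum)
qed

lemma ray_seq_eventually_zero:
  assumes "finite {x. f x \<noteq> 0}"
  shows "\<exists>N. \<forall>n\<ge>N. ray_seq f n = 0"
proof -
  have "finite ((\<lambda>n. int n + 1) -` {x. f x \<noteq> 0})"
    by (rule finite_vimageI[OF assms]) (simp add: inj_def)
  then have "finite {n. ray_seq f n \<noteq> 0}" by (simp add: ray_seq_def vimage_def)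
  then obtain N where "\<forall>n\<in>{n. ray_seq f n \<noteq> 0}. n < N"
    using finite_nat_set_iff_bounded by blast
  then show ?thesis by (metis (mono_tags) mem_Collect_eq not_le)
qed

lemma ray_lap_eventually_zero:
  assumes f: "\<And>n. N \<le> n \<Longrightarrow> ray_seq f n = 0" and n: "Suc N \<le> n"
  shows "ray_seq (ray_lap f) n = 0"
proof -
  obtain k where k: "n = Suc k" "N \<le> k" using n by (cases n) auto
  then show ?thesis
    using ray_lap_Suc[of f k] f[of k] f[of "Suc k"] f[of "Suc (Suc k)"] ray_m_pos[of n]
    by (simp add: ray_flux_def)
qed

lemma finite_support_ray_lap:
  assumes "finite {x. f x \<noteq> 0}"
  shows "finite {x. ray_lap f x \<noteq> 0}"
proof -
  obtain N where N: "\<And>n. N \<le> n \<Longrightarrow> ray_seq f n = 0"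
    using ray_seq_eventually_zero[OF assms] by blast
  have "{x. ray_lap f x \<noteq> 0} \<subseteq> {1..int N + 1}"
  proof
    fix x assume x: "x \<in> {x. ray_lap f x \<noteq> 0}"
    then have x1: "1 \<le> x" using ray_lap_outside[of x f] by (auto simp: not_le[symmetric])
    have "nat (x - 1) < Suc N"
    proof (rule ccontr)
      assume "\<not> nat (x - 1) < Suc N"
      then have "ray_seq (ray_lap f) (nat (x - 1)) = 0"
        using ray_lap_eventually_zero[of N f "nat (x - 1)"] N by auto
      then show False using x x1 by (simp add: ray_seq_def)
    qed
    then show "x \<in> {1..int N + 1}" using x1 by auto
  qed
  then show ?thesis by (rule finite_subset) simp
qed

text \<open>Green's formula summed past the support of \<open>f\<close>, where the Wronskian
  vanishes. Both inner products are finite sums, whatever the growth of \<open>u\<close>.\<close>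

lemma inner_ray_lap_finite_support:
  assumes "finite {x. f x \<noteq> 0}"
  shows "wl2_inner {1..} m (ray_lap f) u = wl2_inner {1..} m f (ray_lap u)"
proof -
  obtain N where N: "\<And>n. N \<le> n \<Longrightarrow> ray_seq f n = 0"
    using ray_seq_eventually_zero[OF assms] by blast
  \<comment> \<open>The Laplacian of \<open>f\<close> can reach one vertex past the support, hence
    the range \<open>Suc N\<close>.\<close>
  have eq: "wl2_inner {1..} m g h = (\<Sum>k<Suc N. ray_seq g k * ray_seq h k * ray_seq m k)"
    if g: "\<And>n. Suc N \<le> n \<Longrightarrow> ray_seq g n = 0" for g h
  proof -
    have "wl2_inner {1..} m g h = (\<Sum>\<^sub>\<infinity>k\<in>{..<Suc N}. ray_seq g k * ray_seq h k * ray_seq m k)"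
      unfolding wl2_inner_ray by (rule infsum_cong_neutral) (auto simp: g)
    then show ?thesis by simp
  qed
  have "wl2_inner {1..} m (ray_lap f) u - wl2_inner {1..} m f (ray_lap u) =
    (\<Sum>k<Suc N. (ray_seq (ray_lap f) k * ray_seq u k - ray_seq f k * ray_seq (ray_lap u) k) * ray_seq m k)"
    using ray_lap_eventually_zero[of N f] N
    by (simp add: eq left_diff_distrib sum_subtractf del: sum.lessThan_Suc)
  also have "\<dots> = 0"
    unfolding ray_green using N by simp
  finally show ?thesis by simp
qed

section \<open>The maximal operator on the ray and its boundary form\<close>

abbreviation ray_op :: "int op_graph" where
  "ray_op \<equiv> laplacian_c {1..} b m"

text \<open>Testing the adjoint relation on the indicator of a single vertex determines
  \<open>snd q\<close> on the ray, and membership in \<open>wl2\<close> fixes it outside. The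
  converse is Green's formula for finitely supported functions.\<close>

lemma adjoint_ray_op_iff:
  "q \<in> adjoint_op {1..} m ray_op \<longleftrightarrow>
     fst q \<in> wl2 {1..} m \<and> snd q \<in> wl2 {1..} m \<and> snd q = ray_lap (fst q)"
proof
  assume q: "q \<in> adjoint_op {1..} m ray_op"
  obtain u v where uv: "q = (u, v)" by (cases q)
  have W: "u \<in> wl2 {1..} m" "v \<in> wl2 {1..} m" using q uv by (auto simp: adjoint_op_def)
  have "v x = ray_lap u x" for x
  proof (cases "1 \<le> x")
    case True
    define d :: "int \<Rightarrow> real" where "d y = (if y = x then 1 else 0)" for y
    have supp: "{y. d y \<noteq> 0} = {x}" by (auto simp: d_def)
    have inner: "wl2_inner {1..} m d w = w x * m x" for w
    proof -
      have "wl2_inner {1..} m d w = (\<Sum>\<^sub>\<infinity>y\<in>{x}. w y * m y)"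
        unfolding wl2_inner_def by (rule infsum_cong_neutral) (use True in \<open>auto simp: d_def\<close>)
      then show ?thesis by simp
    qed
    have "(d, ray_lap d) \<in> ray_op" using supp True by (auto simp: laplacian_c_def)
    then have "wl2_inner {1..} m (ray_lap d) u = wl2_inner {1..} m d v"
      using q uv by (auto simp: adjoint_op_def)
    then have "ray_lap u x * m x = v x * m x"
      using inner_ray_lap_finite_support[of d u] supp by (simp add: inner)
    then show ?thesis using m_pos[of x] by simp
  next
    case False
    then show ?thesis using W ray_lap_outside[of x u] by (simp add: wl2_def)
  qed
  then show "fst q \<in> wl2 {1..} m \<and> snd q \<in> wl2 {1..} m \<and> snd q = ray_lap (fst q)"
    using W uv by auto
next
  assume "fst q \<in> wl2 {1..} m \<and> snd q \<in> wl2 {1..} m \<and> snd q = ray_lap (fst q)"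
  then show "q \<in> adjoint_op {1..} m ray_op"
    by (cases q) (auto simp: adjoint_op_def laplacian_c_def inner_ray_lap_finite_support)
qed

text \<open>By local finiteness the Laplacian preserves finite support, so its values on such
  functions lie in \<open>wl2\<close>.\<close>

lemma ray_op_subset_adjoint: "ray_op \<subseteq> adjoint_op {1..} m ray_op"
proof
  fix q assume "q \<in> ray_op"
  then obtain f where f: "q = (f, ray_lap f)" "finite {x. f x \<noteq> 0}" "{x. f x \<noteq> 0} \<subseteq> {1..}"
    by (auto simp: laplacian_c_def)
  moreover have "{x. ray_lap f x \<noteq> 0} \<subseteq> {1..}"
    using ray_lap_outside[of _ f] by (auto simp: not_le[symmetric])
  ultimately show "q \<in> adjoint_op {1..} m ray_op"
    by (simp add: adjoint_ray_op_iff wl2_finite_support finite_support_ray_lap)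
qed

lemma linear_adjoint_ray_op: "linear_op {1..} m (adjoint_op {1..} m ray_op)"
  unfolding linear_op_def
proof (intro conjI allI impI)
  show "adjoint_op {1..} m ray_op \<subseteq> wl2 {1..} m \<times> wl2 {1..} m"
    by (auto simp: adjoint_op_def)
  show "single_valued (adjoint_op {1..} m ray_op)"
    by (auto simp: single_valued_def adjoint_ray_op_iff)
  show "(\<lambda>x. 0, \<lambda>x. 0) \<in> adjoint_op {1..} m ray_op"
    using laplacian_scale[of "{1..}" 0 "\<lambda>x. 0"] by (simp add: adjoint_ray_op_iff wl2_def)
qed (auto simp: adjoint_ray_op_iff laplacian_add laplacian_scale wl2_add[OF m_pos] wl2_scale)

lemma densely_defined_ray_op: "densely_defined {1..} m ray_op"
  unfolding densely_defined_def
proof (intro ballI allI impI)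
  fix f and \<epsilon> :: real assume "f \<in> wl2 {1..} m" "0 < \<epsilon>"
  then obtain h where "finite {x. h x \<noteq> 0}" "{x. h x \<noteq> 0} \<subseteq> {1..}"
    "wl2_norm {1..} m (\<lambda>x. f x - h x) < \<epsilon>"
    using finite_support_dense[of m f "{1..}" \<epsilon>] m_pos by blast
  moreover from this have "h \<in> Domain ray_op" by (auto simp: laplacian_c_def)
  ultimately show "\<exists>h\<in>Domain ray_op. wl2_norm {1..} m (\<lambda>x. f x - h x) < \<epsilon>" by blast
qed

text \<open>By \<open>ray_green\<close> the Wronskians are the partial sums of the series for the
  boundary form.\<close>

lemma boundary_form_limit:
  assumes p: "p \<in> adjoint_op {1..} m ray_op" and q: "q \<in> adjoint_op {1..} m ray_op"
  shows "(\<lambda>n. ray_edge b n *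
      (ray_seq (fst p) n * ray_seq (fst q) (Suc n) - ray_seq (fst p) (Suc n) * ray_seq (fst q) n))
    \<longlonglongrightarrow> boundary_form {1..} m p q"
proof -
  let ?f = "fst p" and ?u = "fst q"
  have W: "?f \<in> wl2 {1..} m" "?u \<in> wl2 {1..} m" "ray_lap ?f \<in> wl2 {1..} m" "ray_lap ?u \<in> wl2 {1..} m"
    and s: "snd p = ray_lap ?f" "snd q = ray_lap ?u"
    using p q by (auto simp: adjoint_ray_op_iff)
  have "(\<lambda>k. (ray_seq (ray_lap ?f) k * ray_seq ?u k - ray_seq ?f k * ray_seq (ray_lap ?u) k) * ray_seq m k)
    sums boundary_form {1..} m p q"
    unfolding boundary_form_def s left_diff_distrib by (intro sums_diff wl2_inner_ray_sums W)
  then show ?thesis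
    \<comment> \<open>The Wronskian at \<open>n\<close> sums \<open>Suc n\<close> terms, hence the
      index shift.\<close>
    unfolding sums_def using LIMSEQ_Suc ray_green[of ?f ?u] by fastforce
qed

text \<open>Contrapositive of \<open>infinite_energy_imp\<close>, with the flux as \<open>p\<close>
  and the Laplacian as \<open>v\<close>; their product condition holds because \<open>fst q\<close>
  and its Laplacian are both in \<open>wl2\<close>.\<close>

lemma finite_energy:
  assumes q: "q \<in> adjoint_op {1..} m ray_op"
    and ns: "\<not> summable (\<lambda>n. (\<Sum>k<n. 1 / ray_edge b k)\<^sup>2 * ray_seq m n)"
  shows "summable (\<lambda>n. ray_edge b n * (ray_seq (fst q) (Suc n) - ray_seq (fst q) n)\<^sup>2)"
proof (rule ccontr)
  assume E: "\<not> ?thesis"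
  have W: "fst q \<in> wl2 {1..} m" "ray_lap (fst q) \<in> wl2 {1..} m"
    using q by (auto simp: adjoint_ray_op_iff)
  have "summable (\<lambda>n. (\<Sum>k<n. 1 / ray_edge b k)\<^sup>2 * ray_seq m n)"
  proof (rule infinite_energy_imp[where p = "ray_flux b (fst q)" and v = "ray_seq (ray_lap (fst q))"])
    show "summable (\<lambda>n. (ray_seq (fst q) n)\<^sup>2 * ray_seq m n)" using W by (simp add: wl2_ray_iff)
    show "summable (\<lambda>n. \<bar>ray_seq (fst q) n * ray_seq (ray_lap (fst q)) n * ray_seq m n\<bar>)"
      by (rule summable_on_imp_summable[OF ray_mult_summable_on[OF W]])
  qed (rule ray_edge_pos ray_m_pos ray_flux_def ray_lap_0 ray_lap_Suc E)+
  with ns show False ..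
qed

text \<open>This is Weyl's limit point and limit circle alternative on a recurrent ray. There the
  unbounded \<open>S\<close> dominates the constants, so its square-summability alone
  decides.\<close>

lemma essentially_self_adjoint_ray_iff:
  assumes rec: "\<not> summable (\<lambda>n. 1 / ray_edge b n)"
  shows "essentially_self_adjoint {1..} m ray_op \<longleftrightarrow>
    \<not> summable (\<lambda>n. (\<Sum>k<n. 1 / ray_edge b k)\<^sup>2 * ray_seq m n)"
proof
  assume ns: "\<not> summable (\<lambda>n. (\<Sum>k<n. 1 / ray_edge b k)\<^sup>2 * ray_seq m n)"
  show "essentially_self_adjoint {1..} m ray_op"
  proof (rule essentially_self_adjointI[OF linear_adjoint_ray_op densely_defined_ray_op ray_op_subset_adjoint])
    fix p q assume pq: "p \<in> adjoint_op {1..} m ray_op" "q \<in> adjoint_op {1..} m ray_op"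
    show "boundary_form {1..} m p q = 0"
      by (rule wronskian_limit_zero[OF ray_edge_pos rec finite_energy[OF pq(1) ns]
            finite_energy[OF pq(2) ns] boundary_form_limit[OF pq]])
  qed
next
  assume esa: "essentially_self_adjoint {1..} m ray_op"
  define S where "S n = (\<Sum>k<n. 1 / ray_edge b k)" for n
  show "\<not> summable (\<lambda>n. (\<Sum>k<n. 1 / ray_edge b k)\<^sup>2 * ray_seq m n)"
  proof
    assume "summable (\<lambda>n. (\<Sum>k<n. 1 / ray_edge b k)\<^sup>2 * ray_seq m n)"
    then have S: "summable (\<lambda>n. (S n)\<^sup>2 * ray_seq m n)" by (simp add: S_def)
    have S_top: "filterlim S at_top sequentially"
      unfolding S_def using ray_edge_pos rec
      by (intro filterlim_partial_sums_at_top) (auto simp: less_imp_le)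
    have "summable (\<lambda>n. 1\<^sup>2 * ray_seq m n)"
    proof (rule summable_square_comparison[OF _ _ S])
      have "\<forall>\<^sub>F n in sequentially. 1 \<le> S n" using S_top by (simp only: filterlim_at_top)
      then show "\<forall>\<^sub>F n in sequentially. \<bar>1\<bar> \<le> 1 * \<bar>S n\<bar>" by eventually_elim simp
    qed (simp add: ray_m_pos less_imp_le)
    then have one: "ray_extend (\<lambda>n. 1) \<in> wl2 {1..} m"
      by (simp add: wl2_ray_iff ray_extend_def[of _ "_ :: int"])
    have Sw: "ray_extend S \<in> wl2 {1..} m"
      using S by (simp add: wl2_ray_iff ray_extend_def[of _ "_ :: int"])
    have flux_one: "ray_flux b (ray_extend (\<lambda>n. 1)) n = 0" for n
      by (simp add: ray_flux_def)
    have flux_S: "ray_flux b (ray_extend S) n = 1" for n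
      using ray_edge_pos[of n] by (simp add: ray_flux_def S_def)
    have lap_one: "ray_lap (ray_extend (\<lambda>n. 1)) = (\<lambda>x. 0)"
    proof (rule ray_eqI)
      fix n
      show "ray_seq (ray_lap (ray_extend (\<lambda>n. 1))) n = ray_seq (\<lambda>x. 0) n"
        using ray_lap_0[of "ray_extend (\<lambda>n. 1)"] ray_lap_Suc[of "ray_extend (\<lambda>n. 1)" "n - 1"]
          ray_m_pos[of n]
        by (cases n) (auto simp: flux_one ray_seq_def[of "\<lambda>x. 0"])
    qed (simp add: ray_lap_outside)
    \<comment> \<open>Harmonicity fails at vertex \<open>1\<close>, where the unit flux through the
      first edge is unbalanced. This single term does not affect square-summability.\<close>
    have lap_S: "ray_seq (ray_lap (ray_extend S)) (Suc n) = 0" for n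
      using ray_lap_Suc[of "ray_extend S" n] ray_m_pos[of "Suc n"] by (simp add: flux_S)
    have "summable (\<lambda>n. (ray_seq (ray_lap (ray_extend S)) n)\<^sup>2 * ray_seq m n)"
      by (subst summable_Suc_iff[symmetric]) (simp add: lap_S)
    then have lap_Sw: "ray_lap (ray_extend S) \<in> wl2 {1..} m"
      by (simp add: wl2_ray_iff ray_lap_outside)
    define \<phi> where "\<phi> = (ray_extend (\<lambda>n. 1), \<lambda>x::int. 0::real)"
    define \<psi> where "\<psi> = (ray_extend S, ray_lap (ray_extend S))"
    have \<phi>: "\<phi> \<in> adjoint_op {1..} m ray_op"
      using one by (simp add: \<phi>_def adjoint_ray_op_iff lap_one wl2_def)
    have \<psi>: "\<psi> \<in> adjoint_op {1..} m ray_op"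
      using Sw lap_Sw by (simp add: \<psi>_def adjoint_ray_op_iff)
    \<comment> \<open>The Wronskian of the constant \<open>1\<close> with \<open>S\<close> is the
      flux of \<open>S\<close>, equal to \<open>1\<close> at every edge.\<close>
    have "(\<lambda>n. 1) \<longlonglongrightarrow> boundary_form {1..} m \<phi> \<psi>"
      using boundary_form_limit[OF \<phi> \<psi>] flux_S by (simp add: \<phi>_def \<psi>_def ray_flux_def)
    then have nz: "boundary_form {1..} m \<phi> \<psi> \<noteq> 0"
      using LIMSEQ_unique[OF tendsto_const] by fastforce
    have pl: "boundary_form {1..} m p q * boundary_form {1..} m \<phi> \<psi> =
      boundary_form {1..} m p \<phi> * boundary_form {1..} m q \<psi> -
      boundary_form {1..} m p \<psi> * boundary_form {1..} m q \<phi>"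
      if p: "p \<in> adjoint_op {1..} m ray_op" and q: "q \<in> adjoint_op {1..} m ray_op" for p q
    proof -
      \<comment> \<open>\<open>W p q n\<close> is \<open>ray_edge b n\<close> times a two-by-two
        determinant. The Pluecker relation is exact at every \<open>n\<close> and passes to the
        limit.\<close>
      define W where "W p q n = ray_edge b n *
        (ray_seq (fst p) n * ray_seq (fst q) (Suc n) - ray_seq (fst p) (Suc n) * ray_seq (fst q) n)"
        for p q :: "(int \<Rightarrow> real) \<times> (int \<Rightarrow> real)" and n
      have lim: "W r s \<longlonglongrightarrow> boundary_form {1..} m r s"
        if "r \<in> adjoint_op {1..} m ray_op" "s \<in> adjoint_op {1..} m ray_op" for r s
        unfolding W_def by (rule boundary_form_limit[OF that])
      have "(\<lambda>n. W p q n * W \<phi> \<psi> n) \<longlonglongrightarrow> boundary_form {1..} m p q * boundary_form {1..} m \<phi> \<psi>"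
        by (intro tendsto_intros lim p q \<phi> \<psi>)
      moreover have "(\<lambda>n. W p \<phi> n * W q \<psi> n - W p \<psi> n * W q \<phi> n) \<longlonglongrightarrow>
        boundary_form {1..} m p \<phi> * boundary_form {1..} m q \<psi> -
        boundary_form {1..} m p \<psi> * boundary_form {1..} m q \<phi>"
        by (intro tendsto_intros lim p q \<phi> \<psi>)
      moreover have "W p q n * W \<phi> \<psi> n = W p \<phi> n * W q \<psi> n - W p \<psi> n * W q \<phi> n" for n
        unfolding W_def by algebra
      ultimately show ?thesis by (simp add: LIMSEQ_unique)
    qed
    have "\<not> essentially_self_adjoint {1..} m ray_op"
      by (rule not_essentially_self_adjointI[OF m_pos linear_adjoint_ray_op densely_defined_ray_op
            ray_op_subset_adjoint \<phi> \<psi> nz pl])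
    with esa show False by contradiction
  qed
qed

end

section \<open>Harmonic functions on the line\<close>

context star
begin

text \<open>Resistance between \<open>- r\<close> and minus infinity, written like the inner sum of
  \<open>green_l2_neg\<close>.\<close>

definition neg_resistance :: "nat \<Rightarrow> real" where
  "neg_resistance r = (\<Sum>k. 1 / b (- int (r + k)) (- int (r + k) - 1))"

text \<open>The voltage that vanishes at \<open>-\<infinity>\<close> and has unit flux through every edge.\<close>

definition potential :: "int \<Rightarrow> real" where
  "potential x = (if x \<le> 0 then neg_resistance (nat (- x))
     else neg_resistance 0 + (\<Sum>k<nat x. 1 / b (int k) (int k + 1)))"

lemma neg_resistance_Suc:
  assumes "transient_neg b"
  shows "neg_resistance r = 1 / b (- int r) (- int r - 1) + neg_resistance (Suc r)"
proof -
  have "summable (\<lambda>k. 1 / b (- int (k + r)) (- int (k + r) - 1))"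
    using assms unfolding transient_neg_def by (rule summable_ignore_initial_segment)
  then have "summable (\<lambda>k. 1 / b (- int (r + k)) (- int (r + k) - 1))"
    by (simp only: add.commute)
  from suminf_split_head[OF this] show ?thesis
    by (simp add: neg_resistance_def)
qed

lemma neg_resistance_tendsto:
  assumes "transient_neg b"
  shows "neg_resistance \<longlonglongrightarrow> 0"
proof -
  define \<sigma> where "\<sigma> k = 1 / b (- int k) (- int k - 1)" for k
  have s: "summable \<sigma>" using assms by (simp add: \<sigma>_def[abs_def] transient_neg_def)
  have "neg_resistance = (\<lambda>r. suminf \<sigma> - (\<Sum>k<r. \<sigma> k))"
  proof
    show "neg_resistance r = suminf \<sigma> - (\<Sum>k<r. \<sigma> k)" for r
      using suminf_minus_initial_segment[OF s, of r]
      by (simp add: neg_resistance_def \<sigma>_def[abs_def] add.commute)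
  qed
  moreover have "(\<lambda>r. suminf \<sigma> - (\<Sum>k<r. \<sigma> k)) \<longlonglongrightarrow> suminf \<sigma> - suminf \<sigma>"
    by (intro tendsto_intros summable_LIMSEQ s)
  ultimately show ?thesis by simp
qed

lemma potential_step:
  assumes "transient_neg b"
  shows "b x (x + 1) * (potential (x + 1) - potential x) = 1"
proof (cases "0 \<le> x")
  case True
  then obtain n where n: "x = int n" using zero_le_imp_eq_int by blast
  \<comment> \<open>For \<open>n = 0\<close> the edge crosses between the two branches of
    \<open>potential\<close>.\<close>
  have "potential (x + 1) - potential x = 1 / b x (x + 1)"
    using n by (cases n) (simp_all add: potential_def nat_add_distrib)
  then show ?thesis using b_pos[of x "x + 1"] by simp
next
  case False
  then obtain r where r: "x = - int (Suc r)"
    using negD by (metis not_le)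
  have nat: "nat (- x) = Suc r" "nat (- (x + 1)) = r" and x1: "- int r = x + 1"
    using r by auto
  have "neg_resistance r = 1 / b (x + 1) x + neg_resistance (Suc r)"
    using neg_resistance_Suc[OF assms, of r] unfolding x1 by simp
  then have "potential (x + 1) - potential x = 1 / b (x + 1) x"
    using False nat by (simp add: potential_def)
  then show ?thesis using b_pos[of x "x + 1"] b_sym[of x "x + 1"] by simp
qed

lemma harmonic_iff:
  "harmonic UNIV b m f \<longleftrightarrow> (\<forall>x. b x (x + 1) * (f (x + 1) - f x) = b (x - 1) x * (f x - f (x - 1)))"
proof -
  have "formal_laplacian UNIV b m f x = 0 \<longleftrightarrow>
    b x (x + 1) * (f (x + 1) - f x) = b (x - 1) x * (f x - f (x - 1))" for x
  proof -
    have "x - 1 \<noteq> x + 1" by simp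
    then have "formal_laplacian UNIV b m f x =
      1 / m x * (b x (x - 1) * (f x - f (x - 1)) + b x (x + 1) * (f x - f (x + 1)))"
      by (simp add: laplacian_eq)
    then have "formal_laplacian UNIV b m f x = 0 \<longleftrightarrow>
      b x (x - 1) * (f x - f (x - 1)) + b x (x + 1) * (f x - f (x + 1)) = 0"
      using m_pos[of x] by simp
    then show ?thesis using b_sym[of x "x - 1"] by (auto simp: algebra_simps)
  qed
  then show ?thesis by (simp add: harmonic_def)
qed

text \<open>Subtracting \<open>c\<close> times the potential of unit flux leaves a function without
  flux, which takes equal values at both ends of every edge.\<close>

lemma harmonic_iff_affine:
  assumes "transient_neg b"
  shows "harmonic UNIV b m f \<longleftrightarrow> (\<exists>a c. f = (\<lambda>x. a + c * potential x))"
proof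
  assume h: "harmonic UNIV b m f"
  define c where "c = b 0 1 * (f 1 - f 0)"
  have flux: "b x (x + 1) * (f (x + 1) - f x) = c" for x
    using int_function_constant[of "\<lambda>x. b x (x + 1) * (f (x + 1) - f x)" x] h
    unfolding harmonic_iff c_def by (metis add.left_neutral add_diff_cancel_right')
  have "f (x + 1) - c * potential (x + 1) = f x - c * potential x" for x
  proof -
    have "b x (x + 1) * (f (x + 1) - f x) = b x (x + 1) * (c * (potential (x + 1) - potential x))"
      using arg_cong[OF potential_step[OF assms, of x], of "\<lambda>t. c * t"] unfolding flux
      by (simp add: mult.left_commute)
    then have "f (x + 1) - f x = c * (potential (x + 1) - potential x)"
      using b_pos[of x "x + 1"] by simp
    then show ?thesis by (simp add: algebra_simps)
  qed
  from int_function_constant[of "\<lambda>x. f x - c * potential x", OF this]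
  have "f x = (f 0 - c * potential 0) + c * potential x" for x by (simp add: algebra_simps)
  then show "\<exists>a c. f = (\<lambda>x. a + c * potential x)" by blast
next
  assume "\<exists>a c. f = (\<lambda>x. a + c * potential x)"
  then obtain a c where f: "f = (\<lambda>x. a + c * potential x)" by blast
  have "b x (x + 1) * (f (x + 1) - f x) = c" for x
    using potential_step[OF assms, of x] unfolding f by algebra
  from this this[of "x - 1" for x] show "harmonic UNIV b m f" unfolding harmonic_iff by simp
qed

section \<open>Square-summability of harmonic functions at both ends of the line\<close>

lemma wl2_UNIV_iff:
  "f \<in> wl2 UNIV m \<longleftrightarrow> summable (\<lambda>n. (ray_seq f n)\<^sup>2 * ray_seq m n) \<and>
     summable (\<lambda>r. (f (- int r))\<^sup>2 * m (- int r))"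
proof -
  let ?q = "\<lambda>x. (f x)\<^sup>2 * m x"
  \<comment> \<open>Vertex \<open>0\<close> goes to the negative half, since
    \<open>green_l2_neg\<close> and \<open>finite_measure_neg\<close> start at
    \<open>r = 0\<close>.\<close>
  have bij: "bij_betw (\<lambda>r. - int r) UNIV {..0}"
    by (rule bij_betwI[where g = "\<lambda>x. nat (- x)"]) auto
  have pos: "?q summable_on {1..} \<longleftrightarrow> summable (\<lambda>n. (ray_seq f n)\<^sup>2 * ray_seq m n)"
    using summable_on_reindex_bij_betw[OF bij_betw_ray, of ?q] m_pos
    by (subst summable_on_UNIV_nonneg_real_iff[symmetric]) (auto simp: ray_seq_def less_imp_le)
  have neg: "?q summable_on {..0} \<longleftrightarrow> summable (\<lambda>r. (f (- int r))\<^sup>2 * m (- int r))"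
    using summable_on_reindex_bij_betw[OF bij, of ?q] m_pos
    by (subst summable_on_UNIV_nonneg_real_iff[symmetric]) (auto simp: less_imp_le)
  have U: "(UNIV :: int set) = {1..} \<union> {..0}" by auto
  have "?q summable_on UNIV \<longleftrightarrow> ?q summable_on {1..} \<and> ?q summable_on {..0}"
  proof (intro iffI conjI)
    show "?q summable_on UNIV" if "?q summable_on {1..} \<and> ?q summable_on {..0}"
      unfolding U by (rule summable_on_Un_disjoint) (use that in auto)
  qed (erule summable_on_subset_banach, simp)+
  then show ?thesis by (simp add: wl2_def pos neg)
qed

text \<open>At plus infinity the potential is unbounded and outweighs \<open>a\<close>. At minus
  infinity it tends to \<open>0\<close>, so \<open>a\<close> dominates unless it is
  \<open>0\<close>, when only the tail resistance remains.\<close>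

lemma affine_potential_wl2_iff:
  assumes tr: "transient_neg b" and rec: "\<not> summable (\<lambda>n. 1 / ray_edge b n)" and c: "c \<noteq> 0"
  shows "(\<lambda>x. a + c * potential x) \<in> wl2 UNIV m \<longleftrightarrow>
    summable (\<lambda>n. (\<Sum>k<n. 1 / ray_edge b k)\<^sup>2 * ray_seq m n) \<and>
    (if a = 0 then green_l2_neg b m else finite_measure_neg m)"
proof -
  \<comment> \<open>Resistance on the ray is counted from vertex \<open>1\<close>; the edge from
    \<open>0\<close> to \<open>1\<close> is absorbed into the constant.\<close>
  have pot: "ray_seq (\<lambda>x. a + c * potential x) n =
    (a + c * potential 1) + c * (\<Sum>k<n. 1 / ray_edge b k)" for n
  proof -
    have "potential (int n + 1) = potential 1 + (\<Sum>k<n. 1 / ray_edge b k)"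
      by (simp add: potential_def nat_add_distrib ray_edge_def sum.lessThan_Suc_shift add_ac
          del: sum.lessThan_Suc)
    then show ?thesis by (simp add: ray_seq_def algebra_simps)
  qed
  have top: "filterlim (\<lambda>n. \<Sum>k<n. 1 / ray_edge b k) at_top sequentially"
    using ray_edge_pos rec by (intro filterlim_partial_sums_at_top) (auto simp: less_imp_le)
  have "summable (\<lambda>n. (ray_seq (\<lambda>x. a + c * potential x) n)\<^sup>2 * ray_seq m n) \<longleftrightarrow>
    summable (\<lambda>n. (\<Sum>k<n. 1 / ray_edge b k)\<^sup>2 * ray_seq m n)"
    unfolding pot by (rule summable_affine_at_top_iff[OF top _ c]) (simp add: ray_m_pos less_imp_le)
  moreover have "summable (\<lambda>r. (a + c * potential (- int r))\<^sup>2 * m (- int r)) \<longleftrightarrow>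
    (if a = 0 then green_l2_neg b m else finite_measure_neg m)"
  proof (cases "a = 0")
    case True
    have "summable (\<lambda>r. (c * neg_resistance r)\<^sup>2 * m (- int r)) \<longleftrightarrow>
      summable (\<lambda>r. (neg_resistance r)\<^sup>2 * m (- int r))"
      using c by (simp add: power_mult_distrib mult.assoc)
    then show ?thesis
      using True tr by (simp add: potential_def green_l2_neg_def neg_resistance_def)
  next
    case False
    then show ?thesis
      using summable_affine_at_zero_iff[OF neg_resistance_tendsto[OF tr], of "\<lambda>r. m (- int r)" a c] m_pos
      by (simp add: potential_def finite_measure_neg_def less_imp_le)
  qed
  ultimately show ?thesis by (simp only: wl2_UNIV_iff)
qed

end

theorem proposition4p44:
  fixes b :: "int \<Rightarrow> int \<Rightarrow> real" and m :: "int \<Rightarrow> real"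
  assumes "star_two_rays b m"
    and "transient_neg b"
    and "\<not> transient_pos b"
  shows "\<not> l2_Liouville UNIV b m \<longleftrightarrow>
    \<not> essentially_self_adjoint {1..} m (laplacian_c {1..} b m) \<and>
    (green_l2_neg b m \<or> finite_measure_neg m)"
proof -
  interpret star b m by (rule star.intro[OF assms(1)])
  \<comment> \<open>The ray omits the edge from \<open>0\<close> to \<open>1\<close>, and dropping
    one term preserves divergence.\<close>
  have rec: "\<not> summable (\<lambda>n. 1 / ray_edge b n)"
    using assms(3) summable_Suc_iff[of "\<lambda>k. 1 / b (int k) (int k + 1)"]
    by (simp add: transient_pos_def ray_edge_def add_ac)
  have const: "(\<lambda>x. a + c * potential x) constant_on UNIV \<longleftrightarrow> c = 0" for a c
  proof
    assume "(\<lambda>x. a + c * potential x) constant_on UNIV"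
    then obtain y where y: "\<And>x. a + c * potential x = y" by (auto simp: constant_on_def)
    have "c * (potential 1 - potential 0) = 0"
      unfolding right_diff_distrib using y[of 0] y[of 1] by linarith
    then show "c = 0" using potential_step[OF assms(2), of 0] by auto
  qed (auto simp: constant_on_def)
  define P where "P \<longleftrightarrow> summable (\<lambda>n. (\<Sum>k<n. 1 / ray_edge b k)\<^sup>2 * ray_seq m n)"
  have wl2: "(\<lambda>x. a + c * potential x) \<in> wl2 UNIV m \<longleftrightarrow>
    P \<and> (if a = 0 then green_l2_neg b m else finite_measure_neg m)" if "c \<noteq> 0" for a c
    unfolding P_def by (rule affine_potential_wl2_iff[OF assms(2) rec that])
  have "\<not> l2_Liouville UNIV b m \<longleftrightarrow>
    (\<exists>a c. c \<noteq> 0 \<and> (\<lambda>x. a + c * potential x) \<in> wl2 UNIV m)"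
    unfolding l2_Liouville_def harmonic_iff_affine[OF assms(2)] using const by blast
  also have "\<dots> \<longleftrightarrow> P \<and> (green_l2_neg b m \<or> finite_measure_neg m)"
  proof
    assume "\<exists>a c. c \<noteq> 0 \<and> (\<lambda>x. a + c * potential x) \<in> wl2 UNIV m"
    then obtain a c where "c \<noteq> 0" "(\<lambda>x. a + c * potential x) \<in> wl2 UNIV m" by blast
    then show "P \<and> (green_l2_neg b m \<or> finite_measure_neg m)"
      using wl2[of c a] by (cases "a = 0") auto
  next
    assume "P \<and> (green_l2_neg b m \<or> finite_measure_neg m)"
    \<comment> \<open>The witness with \<open>a = 0\<close> serves the condition on the Green's
      function, the one with \<open>a = 1\<close> the condition of finite measure.\<close>
    then have "(\<lambda>x. 0 + 1 * potential x) \<in> wl2 UNIV m \<or> (\<lambda>x. 1 + 1 * potential x) \<in> wl2 UNIV m"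
      unfolding wl2[OF one_neq_zero] by simp
    then show "\<exists>a c. c \<noteq> 0 \<and> (\<lambda>x. a + c * potential x) \<in> wl2 UNIV m"
      using one_neq_zero[where 'a = real] by blast
  qed
  finally show ?thesis using essentially_self_adjoint_ray_iff[OF rec] unfolding P_def by simp
qed

end
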